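(* Let $N\ge 2$ be an integer, $R\in(0,1]$, $\alpha\in\mathbb{R}$, and let $B_R=\{x\in\mathbb{R}^N: |x|<R\}$. Let $u\ge 0$ be a distributional solution to $$-\Delta u-\frac{(N-2)^2}{4}|x|^{-2}u\ \ge\ \alpha\,|x|^{-2}\bigl|\log|x|\bigr|^{-2}u\qquad\text{in }\mathcal{D}'(B_R\setminus\{0\}).$$ Assume that there exists $\gamma\le 1$ such that $$u\in L^2_{\rm loc}\bigl(B_R;|x|^{-2}\bigl|\log|x|\bigr|^{-2\gamma}\,dx\bigr),\qquad \alpha\ge\frac14-(1-\gamma)^2.$$ Then $u=0$ almost everywhere in $B_R$.
   Context: A distributional solution to the stated inequality is a function $u\in L^1_{\rm loc}(B_R\setminus\{0\})$ such that $$-\int_{B_R}u\,\Delta\varphi\,dx-\frac{(N-2)^2}{4}\int_{B_R}|x|^{-2}u\varphi\,dx\ \ge\ \alpha\int_{B_R}|x|^{-2}\bigl|\log|x|\bigr|^{-2}u\varphi\,dx$$ for every non-negative $\varphi\in C^\infty_c(B_R\setminus\{0\})$. For a non-negative measurable weight $\omega$, $L^2(\Omega;\omega(x)\,dx)$ is the space of measurable $u$ on $\Omega$ with $\int_\Omega|u|^2\omega\,dx<\infty$. The condition $u\in L^2_{\rm loc}(B_R;\omega\,dx)$ means that $\int_{B_{R'}}|u|^2\omega\,dx<\infty$ for every $R'\in(0,R)$ (so the integrability includes a full neighbourhood of the origin). *)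

theory Defs
  imports "HOL-Analysis.Analysis"
begin

text \<open>Differentiability up to order \<open>k\<close> on the whole space, by recursion over directional
  derivatives in all directions; requiring all orders gives the class \<open>C\<^sup>\<infinity>\<close>.\<close>

fun Ck :: "nat \<Rightarrow> ('a::euclidean_space \<Rightarrow> real) \<Rightarrow> bool" where
  "Ck 0 f \<longleftrightarrow> continuous_on UNIV f"
| "Ck (Suc k) f \<longleftrightarrow>
     (\<forall>x. f differentiable (at x)) \<and> (\<forall>v. Ck k (\<lambda>x. frechet_derivative f (at x) v))"

definition smooth :: "('a::euclidean_space \<Rightarrow> real) \<Rightarrow> bool" where
  "smooth f \<longleftrightarrow> (\<forall>k. Ck k f)"

text \<open>\<open>C\<^sup>\<infinity>\<^sub>c(\<Omega>)\<close>; a test function is represented by its extension by zero to the whole space.\<close>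

definition test_functions :: "'a::euclidean_space set \<Rightarrow> ('a \<Rightarrow> real) set" where
  "test_functions \<Omega> =
     {\<phi>. smooth \<phi> \<and> compact (closure {x. \<phi> x \<noteq> 0}) \<and> closure {x. \<phi> x \<noteq> 0} \<subseteq> \<Omega>}"

definition laplacian :: "('a::euclidean_space \<Rightarrow> real) \<Rightarrow> 'a \<Rightarrow> real" where
  "laplacian \<phi> x =
     (\<Sum>b\<in>Basis. frechet_derivative (\<lambda>y. frechet_derivative \<phi> (at y) b) (at x) b)"

text \<open>The function spaces below contain functions that are total on the ambient space;
  their values outside \<open>\<Omega>\<close> are irrelevant.\<close>

definition L1_loc :: "'a::euclidean_space set \<Rightarrow> ('a \<Rightarrow> real) set" where
  "L1_loc \<Omega> = {u. \<forall>K. compact K \<and> K \<subseteq> \<Omega> \<longrightarrow> set_integrable lebesgue K u}"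

definition weighted_L2 ::
    "'a::euclidean_space set \<Rightarrow> ('a \<Rightarrow> real) \<Rightarrow> ('a \<Rightarrow> real) set" where
  "weighted_L2 \<Omega> \<omega> =
     {u \<in> borel_measurable (lebesgue_on \<Omega>).
        (\<integral>\<^sup>+x. ennreal (\<bar>u x\<bar>\<^sup>2 * \<omega> x) \<partial>lebesgue_on \<Omega>) < \<infinity>}"

text \<open>Local integrability on the ball of radius \<open>R\<close> includes a full neighbourhood of the origin.\<close>

definition weighted_L2_loc_ball ::
    "real \<Rightarrow> ('a::euclidean_space \<Rightarrow> real) \<Rightarrow> ('a \<Rightarrow> real) set" where
  "weighted_L2_loc_ball R \<omega> = {u. \<forall>R'\<in>{0<..<R}. u \<in> weighted_L2 (ball 0 R') \<omega>}"

text \<open>The singular weights are written with \<open>powr\<close>, so that they take the value \<open>0\<close> at the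
  origin, which is a null set.\<close>

definition distributional_solution ::
    "real \<Rightarrow> real \<Rightarrow> (real ^ 'n \<Rightarrow> real) \<Rightarrow> bool" where
  "distributional_solution R \<alpha> u \<longleftrightarrow>
     u \<in> L1_loc (ball 0 R - {0}) \<and>
     (\<forall>\<phi> \<in> test_functions (ball 0 R - {0}). (\<forall>x. 0 \<le> \<phi> x) \<longrightarrow>
        - (LINT x:ball 0 R|lebesgue. u x * laplacian \<phi> x)
        - (real CARD('n) - 2)\<^sup>2 / 4 *
            (LINT x:ball 0 R|lebesgue. norm x powr (-2) * u x * \<phi> x)
        \<ge> \<alpha> * (LINT x:ball 0 R|lebesgue.
                  norm x powr (-2) * \<bar>ln (norm x)\<bar> powr (-2) * u x * \<phi> x))"

end

theory Submission
  imports Defs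
begin

text \<open>
  Put \<open>t = - ln (norm x)\<close> and \<open>\<beta> = \<gamma> - 1/2 \<le> 1/2\<close>, so that \<open>\<beta> * (1 - \<beta>) = 1/4 - (1 - \<gamma>)\<^sup>2 \<le> \<alpha>\<close>, and
  let \<open>\<sigma>' = t powr (-2 * \<beta>)\<close>. For a radial test function
  \<open>norm x powr (- (N - 2) / 2) * t powr \<beta> * k (\<sigma> t)\<close> the left-hand side of the inequality collapses to
  \<open>k''\<close>: the push-forward under \<open>\<sigma>\<close> of \<open>u\<close> times an explicit weight \<open>W\<close> is a nonnegative measure on a
  half-line with concave density, hence nondecreasing, while the integrability of \<open>u\<^sup>2\<close> near the
  origin forces it to become small. Quantitatively, \<open>k\<close> is a tent whose first corner is a fixed bump and
  whose concave corner has width \<open>S\<close> and curvature of order \<open>1 / S\<close>. The bump then tests \<open>W * u\<close>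
  to at most \<open>2 / S\<close> times the integral of \<open>W * u\<close> over \<open>\<sigma> \<in> [c + 2 * S, c + 4 * S]\<close>. By the inequality
  between arithmetic and geometric mean this is bounded by \<open>\<eta>\<close> times a tail of the weighted \<open>L\<^sup>2\<close> norm plus
  \<open>K / \<eta>\<close> with \<open>K\<close> independent of \<open>S\<close>; let \<open>S \<rightarrow> \<infinity>\<close>, then \<open>\<eta> \<rightarrow> \<infinity>\<close>.
\<close>

subsection \<open>Smooth functions on the line\<close>

text \<open>One-dimensional counterpart of \<open>Ck\<close>, localised to a set so that a radial
  profile can be glued from formulas on overlapping open sets. The derivative is two-sided, so the
  notion is meant for open \<open>S\<close>.\<close>

fun Cn_on :: "nat \<Rightarrow> (real \<Rightarrow> real) \<Rightarrow> real set \<Rightarrow> bool" where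
  "Cn_on 0 f S \<longleftrightarrow> continuous_on S f"
| "Cn_on (Suc n) f S \<longleftrightarrow> (\<forall>x\<in>S. f field_differentiable (at x)) \<and> Cn_on n (deriv f) S"

lemma Cn_on_cong:
  assumes "open S" "\<And>x. x \<in> S \<Longrightarrow> f x = g x" "Cn_on n f S"
  shows "Cn_on n g S"
  using assms(2,3)
proof (induction n arbitrary: f g)
  case 0
  then show ?case by (simp cong: continuous_on_cong)
next
  case (Suc n)
  have d: "(g has_field_derivative deriv f x) (at x)" if "x \<in> S" for x
    by (rule has_field_derivative_transform_within_open[where f=f and S=S])
      (use Suc.prems that assms(1) in \<open>auto simp: DERIV_deriv_iff_field_differentiable\<close>)
  have "Cn_on n (deriv g) S"
    by (rule Suc.IH[of "deriv f"]) (use Suc.prems DERIV_imp_deriv[OF d] in auto)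
  then show ?case using d by (auto simp: field_differentiable_def)
qed

lemma Cn_on_SucI:
  assumes "open S" "\<And>x. x \<in> S \<Longrightarrow> (f has_field_derivative f' x) (at x)" "Cn_on n f' S"
  shows "Cn_on (Suc n) f S"
proof -
  have "Cn_on n (deriv f) S"
    by (rule Cn_on_cong[OF assms(1) _ assms(3)]) (use assms(2) DERIV_imp_deriv in fastforce)
  then show ?thesis using assms(2) by (auto simp: field_differentiable_def)
qed

lemma Cn_on_subset: "Cn_on n f S \<Longrightarrow> T \<subseteq> S \<Longrightarrow> Cn_on n f T"
  by (induction n arbitrary: f) (auto intro: continuous_on_subset)

lemma Cn_on_SucD: "Cn_on (Suc n) f S \<Longrightarrow> Cn_on n f S"
  by (induction n arbitrary: f)
    (auto intro!: continuous_at_imp_continuous_on field_differentiable_imp_continuous_at)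

lemma Cn_on_Un: "open S \<Longrightarrow> open T \<Longrightarrow> Cn_on n f S \<Longrightarrow> Cn_on n f T \<Longrightarrow> Cn_on n f (S \<union> T)"
  by (induction n arbitrary: f) (auto intro: continuous_on_open_Un)

lemma Cn_on_const: "open S \<Longrightarrow> Cn_on n (\<lambda>x. c) S"
  by (induction n arbitrary: c) (auto intro!: Cn_on_SucI[where f'="\<lambda>x. 0"] simp del: Cn_on.simps(2))

lemma Cn_on_ident: "open S \<Longrightarrow> Cn_on n (\<lambda>x. x) S"
  by (cases n) (auto intro!: Cn_on_SucI[where f'="\<lambda>x. 1"] Cn_on_const simp del: Cn_on.simps(2))

lemma Cn_on_add:
  "open S \<Longrightarrow> Cn_on n f S \<Longrightarrow> Cn_on n g S \<Longrightarrow> Cn_on n (\<lambda>x. f x + g x) S"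
proof (induction n arbitrary: f g)
  case (Suc n)
  then show ?case
    by (intro Cn_on_SucI[where f'="\<lambda>x. deriv f x + deriv g x"] DERIV_add)
      (auto simp: DERIV_deriv_iff_field_differentiable)
qed (simp add: continuous_on_add)

lemma Cn_on_mult:
  "open S \<Longrightarrow> Cn_on n f S \<Longrightarrow> Cn_on n g S \<Longrightarrow> Cn_on n (\<lambda>x. f x * g x) S"
proof (induction n arbitrary: f g)
  case (Suc n)
  have "Cn_on n f S" "Cn_on n g S"
    using Suc.prems Cn_on_SucD by blast+
  then show ?case using Suc
    by (intro Cn_on_SucI[where f'="\<lambda>x. deriv f x * g x + deriv g x * f x"] DERIV_mult Cn_on_add Suc.IH)
      (auto simp: DERIV_deriv_iff_field_differentiable)
qed (simp add: continuous_on_mult)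

lemma Cn_on_cmult: "open S \<Longrightarrow> Cn_on n f S \<Longrightarrow> Cn_on n (\<lambda>x. c * f x) S"
  by (intro Cn_on_mult Cn_on_const)

lemma Cn_on_compose:
  "open S \<Longrightarrow> open T \<Longrightarrow> Cn_on n f T \<Longrightarrow> Cn_on n g S \<Longrightarrow> g ` S \<subseteq> T \<Longrightarrow> Cn_on n (\<lambda>x. f (g x)) S"
proof (induction n arbitrary: f)
  case 0
  then show ?case by (auto intro: continuous_on_compose2)
next
  case (Suc n)
  have "Cn_on n g S" using Suc.prems Cn_on_SucD by blast
  then have *: "Cn_on n (\<lambda>x. deriv f (g x)) S"
    using Suc.IH[OF Suc.prems(1,2) _ _ Suc.prems(5), of "deriv f"] Suc.prems(3) by simp
  have d: "((\<lambda>x. f (g x)) has_field_derivative deriv f (g x) * deriv g x) (at x)" if "x \<in> S" for x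
    by (rule DERIV_chain2[of f])
      (use Suc.prems that in \<open>simp_all add: DERIV_deriv_iff_field_differentiable image_subset_iff\<close>)
  show ?case
    by (rule Cn_on_SucI[OF Suc.prems(1) d], assumption, rule Cn_on_mult[OF Suc.prems(1) *])
      (use Suc.prems(4) in simp)
qed

lemma Cn_on_powr: "Cn_on n (\<lambda>x. x powr a) {0<..}"
proof (induction n arbitrary: a)
  case (Suc n)
  show ?case
    by (intro Cn_on_SucI[where f'="\<lambda>x. a * x powr (a - 1)"] Cn_on_cmult Suc)
      (auto intro!: has_real_derivative_powr)
qed (simp add: continuous_on_powr)

lemma Cn_on_ln: "Cn_on n ln {0<..}"
proof (cases n)
  case (Suc m)
  show ?thesis unfolding Suc
    by (intro Cn_on_SucI[where f'="\<lambda>x. x powr (- 1)"] Cn_on_powr)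
      (auto intro!: DERIV_ln simp: powr_minus)
qed (simp add: continuous_on_ln)

text \<open>Serves functions known only through their derivative, such as \<open>\<sigma>\<close>
  and the tent \<open>k\<close>: smoothness passes up without a closed formula.\<close>

lemma Cn_on_antiderivative:
  assumes "open S" "\<And>x. x \<in> S \<Longrightarrow> (f has_field_derivative f' x) (at x)" "\<And>n. Cn_on n f' S"
  shows "Cn_on n f S"
  using Cn_on_SucI[OF assms] Cn_on_SucD by blast

subsection \<open>A smooth bump\<close>

text \<open>The standard flat function \<open>exp (- 1 / x)\<close>, with a negative power of
  \<open>x\<close> in front so that the family is closed under differentiation up to linear
  combinations.\<close>

definition flat :: "nat \<Rightarrow> real \<Rightarrow> real" where
  "flat m x = (if x > 0 then inverse x ^ m * exp (- inverse x) else 0)"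

lemma flat_tendsto_0: "(flat m \<longlongrightarrow> 0) (at 0)"
proof -
  have "((\<lambda>y. y ^ m / exp y) \<longlongrightarrow> (0::real)) at_top"
    by (rule tendsto_power_div_exp_0)
  then have "((\<lambda>x. inverse x ^ m / exp (inverse x)) \<longlongrightarrow> (0::real)) (at_right 0)"
    by (rule filterlim_compose) (rule filterlim_inverse_at_top_right)
  then have 1: "(flat m \<longlongrightarrow> 0) (at_right 0)"
    by (rule Lim_transform_eventually)
      (auto simp: flat_def eventually_at_filter exp_minus divide_inverse)
  have 2: "(flat m \<longlongrightarrow> 0) (at_left 0)"
    by (rule tendsto_eventually) (auto simp: flat_def eventually_at_filter)
  show ?thesis using 1 2 by (simp add: filterlim_split_at)
qed

lemma DERIV_flat:
  "(flat m has_field_derivative - real m * flat (Suc m) x + flat (Suc (Suc m)) x) (at x)"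
proof (cases x "0::real" rule: linorder_cases)
  case less
  have "((\<lambda>x. 0) has_field_derivative (0::real)) (at x)" by simp
  then have "(flat m has_field_derivative 0) (at x)"
    by (rule has_field_derivative_transform_within_open[where S="{..<0}"])
      (use less in \<open>auto simp: flat_def\<close>)
  then show ?thesis using less by (simp add: flat_def)
next
  case equal
  \<comment> \<open>The difference quotient at \<open>0\<close> is \<open>flat (Suc m)\<close>,
    since dividing by \<open>x\<close> adds one inverse factor, and it tends to
    \<open>0\<close>.\<close>
  have "(flat m has_field_derivative 0) (at 0)"
    unfolding has_field_derivative_iff
    by (rule Lim_transform_eventually[OF flat_tendsto_0[of "Suc m"]])
      (auto simp: flat_def eventually_at_filter field_simps)
  then show ?thesis using equal by (simp add: flat_def)
next
  case greater
  have "((\<lambda>x. inverse x ^ m * exp (- inverse x)) has_field_derivative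
      - real m * flat (Suc m) x + flat (Suc (Suc m)) x) (at x)"
  proof (rule DERIV_cong)
    show "((\<lambda>x. inverse x ^ m * exp (- inverse x)) has_field_derivative
        - real m * inverse x ^ (m - 1) * (inverse x * inverse x) * exp (- inverse x) +
        exp (- inverse x) * (inverse x * inverse x) * inverse x ^ m) (at x)"
      using greater by (auto intro!: derivative_eq_intros)
    \<comment> \<open>The case split is due to truncated subtraction: for \<open>m = 0\<close> the
      exponent \<open>m - 1\<close> is \<open>0\<close>, but both sides carry the factor
      \<open>real m\<close>.\<close>
    have "real m * inverse x ^ (m - 1) * inverse x = real m * inverse x ^ m"
      by (cases m) auto
    then show "- real m * inverse x ^ (m - 1) * (inverse x * inverse x) * exp (- inverse x) +
        exp (- inverse x) * (inverse x * inverse x) * inverse x ^ m =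
        - real m * flat (Suc m) x + flat (Suc (Suc m)) x"
      using greater by (auto simp add: flat_def algebra_simps)
  qed
  then show ?thesis
    by (rule has_field_derivative_transform_within_open[where S="{0<..}"])
      (use greater in \<open>auto simp: flat_def\<close>)
qed

lemma Cn_on_flat: "Cn_on n (flat m) UNIV"
proof (induction n arbitrary: m)
  case 0
  show ?case
    using DERIV_flat[of m] by (auto intro!: continuous_at_imp_continuous_on DERIV_isCont)
next
  case (Suc n)
  show ?case
    by (rule Cn_on_SucI[OF _ DERIV_flat]) (intro Cn_on_add Cn_on_cmult Suc open_UNIV)+
qed

definition bump :: "real \<Rightarrow> real" where
  "bump s = flat 0 (1 - s) * flat 0 (1 + s)"

lemma Cn_on_bump: "Cn_on n bump UNIV"
proof -
  have "Cn_on n (\<lambda>s. flat 0 (1 + (-1) * s) * flat 0 (1 + s)) UNIV"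
    by (intro Cn_on_mult Cn_on_compose[OF _ _ Cn_on_flat] Cn_on_add Cn_on_const Cn_on_ident Cn_on_cmult) auto
  then show ?thesis by (simp add: bump_def[abs_def])
qed

lemma continuous_on_bump: "continuous_on A bump"
  using Cn_on_bump[of 0] continuous_on_subset by auto

lemma bump_nonneg: "0 \<le> bump s" and bump_le_1: "bump s \<le> 1"
  and bump_minus: "bump (- s) = bump s" and bump_pos: "\<bar>s\<bar> < 1 \<Longrightarrow> 0 < bump s"
  and bump_eq_0: "1 \<le> \<bar>s\<bar> \<Longrightarrow> bump s = 0"
  by (auto simp: bump_def flat_def intro!: mult_le_one)

section \<open>Antiderivatives of the bump and the tent profile\<close>

lemma antiderivative_vanishing_left:
  fixes f :: "real \<Rightarrow> real"
  assumes f: "continuous_on UNIV f" and 0: "\<And>x. x \<le> a \<Longrightarrow> f x = 0"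
  obtains F where "\<And>x. (F has_field_derivative f x) (at x)" "\<And>x. x \<le> a \<Longrightarrow> F x = 0"
proof -
  \<comment> \<open>Starting one unit to the left of \<open>a\<close> changes nothing, as
    \<open>f\<close> vanishes there, and puts every \<open>x \<ge> a\<close> in the interior of the
    integration range, so that the derivative is two-sided.\<close>
  define F where "F x = integral {a-1..x} f" for x
  have F0: "F x = 0" if "x \<le> a" for x
    unfolding F_def by (rule integral_unique, rule has_integral_is_0) (use 0 that in auto)
  have "(F has_field_derivative f x) (at x)" for x
  proof (cases "x < a")
    case True
    have "((\<lambda>x. 0) has_field_derivative f x) (at x)" using 0[of x] True by simp
    then show ?thesis
      by (rule has_field_derivative_transform_within_open[where S="{..<a}"]) (use True F0 in auto)
  next
    case False
    have "(F has_field_derivative f x) (at x within {a-1..x+1})"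
      unfolding F_def by (rule integral_has_real_derivative) (use f False continuous_on_subset in auto)
    then show ?thesis
      using False by (subst (asm) at_within_interior) auto
  qed
  then show thesis using that F0 by blast
qed

text \<open>\<open>B\<close> is \<open>m * max s 0\<close> with its corner rounded off on
  \<open>[-1, 1]\<close>. Evenness of the bump centres its mass at \<open>0\<close>, which is why
  \<open>B s\<close> is exactly \<open>m * s\<close>, without additive constant, once
  \<open>1 \<le> s\<close>.\<close>

lemma bump_antiderivatives:
  obtains B B1 :: "real \<Rightarrow> real" and m where
    "\<And>s. (B has_field_derivative B1 s) (at s)" "\<And>s. (B1 has_field_derivative bump s) (at s)"
    "0 < m" "\<And>s. s \<le> -1 \<Longrightarrow> B s = 0" "\<And>s. 1 \<le> s \<Longrightarrow> B s = m * s"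
    "\<And>s. 0 \<le> B s" "\<And>s. m * s \<le> B s" "\<And>s. -1 \<le> s \<Longrightarrow> B s \<le> m * (s + 1)"
proof -
  obtain B1 where B1: "\<And>s. (B1 has_field_derivative bump s) (at s)" "\<And>s. s \<le> -1 \<Longrightarrow> B1 s = 0"
    by (rule antiderivative_vanishing_left[of bump "-1"]) (auto simp: continuous_on_bump bump_eq_0)
  have "continuous_on UNIV B1"
    using B1(1) by (auto intro!: continuous_at_imp_continuous_on DERIV_isCont)
  then obtain B where B: "\<And>s. (B has_field_derivative B1 s) (at s)" "\<And>s. s \<le> -1 \<Longrightarrow> B s = 0"
    using antiderivative_vanishing_left[of B1 "-1"] B1(2) by metis
  define m where "m = B1 1"
  have mono: "B1 s \<le> B1 t" if "s \<le> t" for s t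
    by (rule DERIV_nonneg_imp_nondecreasing[OF that]) (use B1(1) bump_nonneg in blast)
  have B1_nonneg: "0 \<le> B1 s" for s
    using mono[of "min s (-1)" s] B1(2)[of "min s (-1)"] by simp
  have B1_eq: "B1 s = m" if "1 \<le> s" for s
  proof -
    have "B1 s \<le> B1 1"
      by (rule DERIV_nonpos_imp_nonincreasing[OF that, where f=B1])
        (use B1(1) bump_eq_0 in \<open>metis abs_ge_self order.refl order.trans\<close>)
    then show ?thesis using mono[OF that] m_def by simp
  qed
  have B1_le: "B1 s \<le> m" for s
    using mono[of s "max s 1"] B1_eq[of "max s 1"] by simp
  have m: "0 < m"
  proof -
    have "B1 (-1/2) < B1 (1/2)"
    proof (rule DERIV_pos_imp_increasing[where f=B1])
      show "\<exists>y. DERIV B1 x :> y \<and> 0 < y" if "-1/2 \<le> x" "x \<le> 1/2" for x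
        using that B1(1)[of x] bump_pos[of x] by auto
    qed simp
    then show ?thesis using B1_nonneg[of "-1/2"] B1_le[of "1/2"] by simp
  qed
  have B_nonneg: "0 \<le> B s" for s
  proof -
    have "B (min s (-1)) \<le> B s"
      by (rule DERIV_nonneg_imp_nondecreasing) (use B(1) B1_nonneg in auto)
    then show ?thesis using B(2) by simp
  qed
  \<comment> \<open>Evenness makes this sum constant, and its value at \<open>1\<close> is
    \<open>m\<close>. Integrated once more, the reflection turns vanishing on the left into
    linearity on the right.\<close>
  have B1_refl: "B1 s + B1 (- s) = m" for s
  proof -
    have "\<forall>x. ((\<lambda>s. B1 s + B1 (- s)) has_field_derivative 0) (at x)"
      by (auto intro!: derivative_eq_intros B1(1) DERIV_chain2[OF B1(1)] simp: bump_minus)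
    then have "B1 s + B1 (- s) = B1 1 + B1 (- 1)"
      by (rule DERIV_isconst_all)
    then show ?thesis using B1(2)[of "-1"] m_def by simp
  qed
  have B_refl: "B s - B (- s) = m * s" for s
  proof -
    have "\<forall>x. ((\<lambda>s. B s - B (- s) - m * s) has_field_derivative 0) (at x)"
      using B1_refl
      by (auto intro!: derivative_eq_intros B(1) DERIV_chain2[OF B(1)] simp: algebra_simps)
    then have "B s - B (- s) - m * s = B 0 - B (- 0) - m * 0"
      by (rule DERIV_isconst_all)
    then show ?thesis by simp
  qed
  have B_le: "B s \<le> m * (s + 1)" if "-1 \<le> s" for s
  proof -
    have "B s - m * s \<le> B (-1) - m * (-1)"
    proof (rule DERIV_nonpos_imp_nonincreasing[OF that, where f="\<lambda>s. B s - m * s"])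
      fix x
      have "((\<lambda>s. B s - m * s) has_field_derivative B1 x - m) (at x)"
        by (auto intro!: derivative_eq_intros B(1))
      then show "\<exists>y. DERIV (\<lambda>s. B s - m * s) x :> y \<and> y \<le> 0" using B1_le[of x] by auto
    qed
    then show ?thesis using B(2)[of "-1"] by (simp add: algebra_simps)
  qed
  have "B s = m * s" if "1 \<le> s" for s
    using B_refl[of s] B(2)[of "- s"] that by simp
  moreover have "m * s \<le> B s" for s
    using B_refl[of s] B_nonneg[of "- s"] by simp
  ultimately show thesis
    using that B B1(1) m B_nonneg B_le by blast
qed

text \<open>A smoothed tent function: the convex corner at \<open>c\<close> has width \<open>e\<close> independent of the
  size \<open>S\<close>, and the only concave corner is spread out over \<open>[c + 2 * S, c + 4 * S]\<close>.\<close>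

lemma tent_function:
  fixes c e S :: real
  assumes "0 < e" "e \<le> S"
  obtains k k1 where
    "\<And>s. (k has_field_derivative k1 s) (at s)"
    "\<And>s. (k1 has_field_derivative bump ((s - c) / e) / e - 2 * bump ((s - (c + 3 * S)) / S) / S
       + bump ((s - (c + 6 * S)) / S) / S) (at s)"
    "\<And>n. Cn_on n k UNIV" "\<And>s. 0 \<le> k s" "\<And>s. s \<le> c - e \<Longrightarrow> k s = 0" "\<And>s. c + 7 * S \<le> s \<Longrightarrow> k s = 0"
proof -
  obtain B B1 m where B: "\<And>s. (B has_field_derivative B1 s) (at s)" "\<And>s. (B1 has_field_derivative bump s) (at s)"
    "0 < m" "\<And>s. s \<le> -1 \<Longrightarrow> B s = 0" "\<And>s. 1 \<le> s \<Longrightarrow> B s = m * s"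
    "\<And>s. 0 \<le> B s" "\<And>s. m * s \<le> B s" "\<And>s. -1 \<le> s \<Longrightarrow> B s \<le> m * (s + 1)"
    by (rule bump_antiderivatives) blast
  have S: "0 < S" using assms by simp
  \<comment> \<open>Three rounded corners with weights \<open>1\<close>, \<open>-2\<close>,
    \<open>1\<close> give the slopes \<open>0\<close>, \<open>m\<close>, \<open>-m\<close>,
    \<open>0\<close>. Equal spacing makes the affine parts cancel on the right, and
    \<open>e \<le> S\<close> keeps the rounded zones disjoint.\<close>
  define k where "k s = e * B ((s - c) / e) - 2 * S * B ((s - (c + 3 * S)) / S)
    + S * B ((s - (c + 6 * S)) / S)" for s
  define k1 where "k1 s = B1 ((s - c) / e) - 2 * B1 ((s - (c + 3 * S)) / S)
    + B1 ((s - (c + 6 * S)) / S)" for s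
  define k2 where "k2 s = bump ((s - c) / e) / e - 2 * bump ((s - (c + 3 * S)) / S) / S
    + bump ((s - (c + 6 * S)) / S) / S" for s
  have k: "(k has_field_derivative k1 s) (at s)" for s
    unfolding k_def k1_def using S assms(1)
    by (auto intro!: derivative_eq_intros DERIV_chain2[OF B(1)])
  have k1: "(k1 has_field_derivative k2 s) (at s)" for s
    unfolding k1_def k2_def using S assms(1)
    by (auto intro!: derivative_eq_intros DERIV_chain2[OF B(2)])
  have scaled: "Cn_on n (\<lambda>s. bump ((s - a) / b) / b) UNIV" for n a b
  proof -
    have "Cn_on n (\<lambda>s. (1 / b) * bump ((1 / b) * (s + (- a)))) UNIV"
      by (intro Cn_on_cmult Cn_on_compose[OF _ _ Cn_on_bump] Cn_on_add Cn_on_const Cn_on_ident) auto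
    then show ?thesis by (simp add: mult.commute)
  qed
  have "Cn_on n (\<lambda>s. bump ((s - c) / e) / e + (- 2) * (bump ((s - (c + 3 * S)) / S) / S)
    + bump ((s - (c + 6 * S)) / S) / S) UNIV" for n
    by (intro Cn_on_add Cn_on_cmult scaled) auto
  then have "Cn_on n k2 UNIV" for n
    unfolding k2_def by simp
  then have "Cn_on n k1 UNIV" for n
    using Cn_on_antiderivative k1 by blast
  then have smooth: "Cn_on n k UNIV" for n
    using Cn_on_antiderivative k by blast
  have ge: "m * (s - a) \<le> b * B ((s - a) / b)" if "0 < b" for s a b
    using mult_left_mono[OF B(7)[of "(s - a) / b"], of b] that by simp
  have le: "b * B ((s - a) / b) \<le> m * (s - a + b)" if "0 < b" "a - b \<le> s" for s a b
  proof -
    have "-1 \<le> (s - a) / b" using that by (simp add: field_simps)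
    from mult_left_mono[OF B(8)[OF this], of b]
    have "b * B ((s - a) / b) \<le> m * (b * ((s - a) / b) + b)"
      using that by (simp add: distrib_left mult_ac)
    then show ?thesis using that by simp
  qed
  have eq: "b * B ((s - a) / b) = m * (s - a)" if "0 < b" "a + b \<le> s" for s a b
  proof -
    have "1 \<le> (s - a) / b" using that by (simp add: field_simps)
    from B(5)[OF this] show ?thesis using that by simp
  qed
  have zero: "B ((s - a) / b) = 0" if "0 < b" "s \<le> a - b" for s a b
    by (rule B(4)) (use that in \<open>simp add: field_simps\<close>)
  have nn: "0 \<le> b * B ((s - a) / b)" if "0 < b" for s a b
    using B(6) that by simp
  have "0 \<le> k s" for s
  proof -
    \<comment> \<open>Only the middle corner is negative. It vanishes to the left of its zone;
      inside, its upper bound stays below the first ramp precisely while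
      \<open>s \<le> c + 4 * S\<close>; to the right the linear lower bounds cancel.\<close>
    consider "s \<le> c + 2 * S" | "c + 2 * S \<le> s" "s \<le> c + 4 * S" | "c + 4 * S \<le> s" by linarith
    then show ?thesis
    proof cases
      case 1
      then show ?thesis unfolding k_def
        using zero[of S s "c + 3 * S"] nn[OF assms(1), of s c] nn[OF S, of s "c + 6 * S"] S by simp
    next
      case 2
      have "2 * (m * (s - (c + 3 * S) + S)) \<le> m * (s - c)"
        using mult_left_mono[of "2 * (s - (c + 3 * S) + S)" "s - c" m] 2 B(3) by (simp add: mult_ac)
      then show ?thesis unfolding k_def
        using le[OF S, of "c + 3 * S" s] ge[OF assms(1), of s c] nn[OF S, of s "c + 6 * S"] 2 by simp
    next
      case 3
      have "m * (s - c) - 2 * (m * (s - (c + 3 * S))) + m * (s - (c + 6 * S)) = 0"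
        by (simp add: algebra_simps)
      then show ?thesis unfolding k_def
        using eq[OF S, of "c + 3 * S" s] ge[OF assms(1), of s c] ge[OF S, of s "c + 6 * S"] 3 by simp
    qed
  qed
  moreover have "k s = 0" if "s \<le> c - e" for s
    unfolding k_def using zero[of e s c] zero[of S s "c + 3 * S"] zero[of S s "c + 6 * S"] that assms S by simp
  moreover have "k s = 0" if "c + 7 * S \<le> s" for s
    unfolding k_def using eq[of e c s] eq[of S "c + 3 * S" s] eq[of S "c + 6 * S" s] that assms S
    by (simp add: algebra_simps)
  ultimately show thesis
    using that[of k k1] k k1 smooth unfolding k2_def by blast
qed

subsection \<open>Radial test functions\<close>

lemma Ck_SucI:
  assumes "\<And>x. (f has_derivative f' x) (at x)" "\<And>v. Ck k (\<lambda>x. f' x v)"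
  shows "Ck (Suc k) f"
  using assms frechet_derivative_at[OF assms(1)] by (auto simp: differentiable_def)

lemma Ck_SucE:
  assumes "Ck (Suc k) f"
  obtains f' where "\<And>x. (f has_derivative f' x) (at x)" "\<And>v. Ck k (\<lambda>x. f' x v)"
  using assms that[of "\<lambda>x. frechet_derivative f (at x)"] by (auto simp: frechet_derivative_works)

lemma Ck_SucD: "Ck (Suc k) f \<Longrightarrow> Ck k f"
  by (induction k arbitrary: f)
    (auto intro!: continuous_at_imp_continuous_on differentiable_imp_continuous_within)

lemma Ck_const: "Ck k (\<lambda>x. c)"
  by (induction k arbitrary: c) (auto intro!: Ck_SucI[where f'="\<lambda>x v. 0"] simp del: Ck.simps(2))

lemma Ck_inner: "Ck k (\<lambda>x. x \<bullet> v)"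
  by (cases k) (auto intro!: Ck_SucI[where f'="\<lambda>x w. w \<bullet> v"] Ck_const continuous_on_inner
      derivative_eq_intros simp del: Ck.simps(2))

lemma Ck_add: "Ck k f \<Longrightarrow> Ck k g \<Longrightarrow> Ck k (\<lambda>x. f x + g x)"
proof (induction k arbitrary: f g)
  case 0
  then show ?case by (simp add: continuous_on_add)
next
  case (Suc k)
  obtain f' where "\<And>x. (f has_derivative f' x) (at x)" "\<And>v. Ck k (\<lambda>x. f' x v)"
    using Ck_SucE[OF Suc.prems(1)] by metis
  moreover obtain g' where "\<And>x. (g has_derivative g' x) (at x)" "\<And>v. Ck k (\<lambda>x. g' x v)"
    using Ck_SucE[OF Suc.prems(2)] by metis
  ultimately show ?case
    by (intro Ck_SucI[where f'="\<lambda>x v. f' x v + g' x v"] has_derivative_add Suc.IH)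
qed

lemma Ck_mult: "Ck k f \<Longrightarrow> Ck k g \<Longrightarrow> Ck k (\<lambda>x. f x * g x)"
proof (induction k arbitrary: f g)
  case 0
  then show ?case by (simp add: continuous_on_mult)
next
  case (Suc k)
  obtain f' where "\<And>x. (f has_derivative f' x) (at x)" "\<And>v. Ck k (\<lambda>x. f' x v)"
    using Ck_SucE[OF Suc.prems(1)] by metis
  moreover obtain g' where "\<And>x. (g has_derivative g' x) (at x)" "\<And>v. Ck k (\<lambda>x. g' x v)"
    using Ck_SucE[OF Suc.prems(2)] by metis
  ultimately show ?case
    using Suc.prems[THEN Ck_SucD]
    by (intro Ck_SucI[where f'="\<lambda>x v. f x * g' x v + f' x v * g x"] has_derivative_mult Ck_add Suc.IH)
qed

text \<open>Radial functions are written through \<open>x \<bullet> x\<close> and not through the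
  norm, because this is smooth at the origin too and the chain rule needs no exception
  there.\<close>

lemma has_derivative_radial:
  fixes F :: "real \<Rightarrow> real" and x :: "'a::real_inner"
  assumes "(F has_field_derivative F') (at (x \<bullet> x))"
  shows "((\<lambda>x. F (x \<bullet> x)) has_derivative (\<lambda>v. F' * (2 * (x \<bullet> v)))) (at x)"
proof -
  have "((\<lambda>x. x \<bullet> x) has_derivative (\<lambda>v. 2 * (x \<bullet> v))) (at x)"
    by (auto intro!: derivative_eq_intros simp: inner_commute)
  from has_derivative_compose[OF this] show ?thesis
    using assms by (simp add: has_field_derivative_def)
qed

lemma Ck_radial: "Cn_on k F UNIV \<Longrightarrow> Ck k (\<lambda>x. F (x \<bullet> x))"
proof (induction k arbitrary: F)
  case 0
  have "continuous_on UNIV (\<lambda>x::'a. F (x \<bullet> x))"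
    by (rule continuous_on_compose2[of UNIV F]) (use 0 in \<open>auto intro!: continuous_on_inner\<close>)
  then show ?case by simp
next
  case (Suc k)
  have d: "(F has_field_derivative deriv F y) (at y)" for y
    using Suc.prems by (simp add: DERIV_deriv_iff_field_differentiable)
  have "Ck k (\<lambda>x::'a. deriv F (x \<bullet> x) * (2 * (x \<bullet> v)))" for v
    by (intro Ck_mult Ck_const Ck_inner Suc.IH) (use Suc.prems in simp)
  then show ?case
    by (intro Ck_SucI[OF has_derivative_radial[OF d]])
qed

lemma laplacian_radial:
  fixes F F1 F2 :: "real \<Rightarrow> real" and x :: "'a::euclidean_space"
  assumes "\<And>y. (F has_field_derivative F1 y) (at y)" "\<And>y. (F1 has_field_derivative F2 y) (at y)"
  shows "laplacian (\<lambda>x. F (x \<bullet> x)) x = 2 * DIM('a) * F1 (x \<bullet> x) + 4 * (x \<bullet> x) * F2 (x \<bullet> x)"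
proof -
  have 1: "frechet_derivative (\<lambda>x::'a. F (x \<bullet> x)) (at y) = (\<lambda>v. F1 (y \<bullet> y) * (2 * (y \<bullet> v)))" for y
    using frechet_derivative_at[OF has_derivative_radial[OF assms(1)]] by metis
  have 2: "frechet_derivative (\<lambda>y::'a. F1 (y \<bullet> y) * (2 * (y \<bullet> b))) (at x) =
      (\<lambda>v. F1 (x \<bullet> x) * (2 * (v \<bullet> b)) + F2 (x \<bullet> x) * (2 * (x \<bullet> v)) * (2 * (x \<bullet> b)))" for b
    by (rule frechet_derivative_at[symmetric], rule has_derivative_mult[OF has_derivative_radial[OF assms(2)]])
      (auto intro!: derivative_eq_intros)
  have "laplacian (\<lambda>x. F (x \<bullet> x)) x =
      (\<Sum>b\<in>Basis. 2 * F1 (x \<bullet> x) + 4 * F2 (x \<bullet> x) * ((x \<bullet> b) * (x \<bullet> b)))"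
    unfolding laplacian_def 1 2 by (intro sum.cong refl) (simp add: algebra_simps)
  also have "\<dots> = 2 * DIM('a) * F1 (x \<bullet> x) + 4 * F2 (x \<bullet> x) * (x \<bullet> x)"
    by (simp add: sum.distrib flip: sum_distrib_left euclidean_inner)
  finally show ?thesis by simp
qed

section \<open>The logarithmic scale and the ground state substitution\<close>

text \<open>\<open>\<sigma>\<close> is \<open>ln\<close> for \<open>\<beta> = 1/2\<close> and a
  multiple of \<open>t powr (1 - 2 * \<beta>)\<close> otherwise; \<open>c0\<close>, equal to
  \<open>1\<close> or \<open>0\<close>, puts both under one identity. The bound on
  \<open>\<beta>\<close> makes \<open>t powr (-2 * \<beta>)\<close> non-integrable at infinity, so
  \<open>\<sigma>\<close> is unbounded and there is room for tents of any size.\<close>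

lemma log_scale:
  fixes \<beta> :: real
  assumes "\<beta> \<le> 1/2"
  obtains \<sigma> :: "real \<Rightarrow> real" and c0 where
    "\<And>t. 0 < t \<Longrightarrow> (\<sigma> has_field_derivative t powr (-2 * \<beta>)) (at t)"
    "\<And>s. 0 < s \<Longrightarrow> \<exists>t>0. \<sigma> t = s" "0 \<le> c0" "c0 \<le> 1"
    "\<And>t. 0 < t \<Longrightarrow> t powr (1 - 2 * \<beta>) = c0 + (1 - 2 * \<beta>) * \<sigma> t"
proof (cases "\<beta> = 1/2")
  case True
  have "\<exists>t>0. ln t = s" for s :: real by (rule exI[of _ "exp s"]) simp
  then show thesis
    by (intro that[of ln 1]) (auto simp: True powr_minus_divide intro!: DERIV_ln_divide)
next
  case False
  define \<kappa> where "\<kappa> = 1 - 2 * \<beta>"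
  have \<kappa>: "0 < \<kappa>" using False assms by (simp add: \<kappa>_def)
  show thesis
  proof (rule that[of "\<lambda>t. t powr \<kappa> / \<kappa>" 0])
    show "((\<lambda>t. t powr \<kappa> / \<kappa>) has_field_derivative t powr (-2 * \<beta>)) (at t)" if "0 < t" for t
      using DERIV_cdivide[OF has_real_derivative_powr[OF that, of \<kappa>], of \<kappa>] \<kappa> by (simp add: \<kappa>_def)
    show "\<exists>t>0. t powr \<kappa> / \<kappa> = s" if "0 < s" for s
      using \<kappa> that by (intro exI[of _ "(\<kappa> * s) powr (1 / \<kappa>)"]) (simp add: powr_powr)
  qed (use \<kappa> in \<open>auto simp: \<kappa>_def\<close>)
qed

lemma log_scale_strict_mono:
  fixes \<sigma> :: "real \<Rightarrow> real"
  assumes "\<And>t. 0 < t \<Longrightarrow> (\<sigma> has_field_derivative t powr (-2 * \<beta>)) (at t)" "0 < s" "s < t"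
  shows "\<sigma> s < \<sigma> t"
proof (rule DERIV_pos_imp_increasing[where f=\<sigma>, OF assms(3)])
  fix x assume "s \<le> x" "x \<le> t"
  then show "\<exists>y. DERIV \<sigma> x :> y \<and> 0 < y"
    using assms(1)[of x] assms(2) by (intro exI[of _ "x powr (-2 * \<beta>)"]) auto
qed

lemma DERIV_eq_0_of_locally_0:
  fixes f :: "real \<Rightarrow> real"
  assumes "open S" "x \<in> S" "\<And>y. y \<in> S \<Longrightarrow> f y = 0" "(f has_field_derivative D) (at x)"
  shows "D = 0"
proof -
  have "((\<lambda>x. 0) has_field_derivative D) (at x)"
    by (rule has_field_derivative_transform_within_open[OF assms(4,1,2)]) (use assms(3) in auto)
  then show ?thesis using DERIV_unique[of "\<lambda>x. 0::real" D x 0] by simp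
qed

text \<open>In the variable \<open>t = - ln (norm x)\<close>, the Laplacian with the critical Hardy term becomes the second
  derivative; the substitution \<open>t powr \<beta> * k (\<sigma> t)\<close> removes the potential \<open>\<beta> * (1 - \<beta>) / t\<^sup>2\<close> as well.\<close>

lemma DERIV_ground_state_substitution:
  fixes \<sigma> k :: "real \<Rightarrow> real"
  assumes \<sigma>: "\<And>t. 0 < t \<Longrightarrow> (\<sigma> has_field_derivative t powr (-2 * \<beta>)) (at t)"
    and k: "\<And>s. (k has_field_derivative k1 s) (at s)" "\<And>s. (k1 has_field_derivative k2 s) (at s)"
    and t: "0 < t"
  defines "G \<equiv> \<lambda>t. t powr \<beta> * k (\<sigma> t)"
    and "G1 \<equiv> \<lambda>t. \<beta> * t powr (\<beta> - 1) * k (\<sigma> t) + t powr (- \<beta>) * k1 (\<sigma> t)"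
    and "G2 \<equiv> \<lambda>t. t powr (-3 * \<beta>) * k2 (\<sigma> t) - \<beta> * (1 - \<beta>) * t powr (-2) * (t powr \<beta> * k (\<sigma> t))"
  shows "(G has_field_derivative G1 t) (at t)" "(G1 has_field_derivative G2 t) (at t)"
proof -
  have 1: "((\<lambda>t. k (\<sigma> t)) has_field_derivative k1 (\<sigma> t) * t powr (-2 * \<beta>)) (at t)"
    by (rule DERIV_chain2[OF k(1) \<sigma>[OF t]])
  have 2: "((\<lambda>t. k1 (\<sigma> t)) has_field_derivative k2 (\<sigma> t) * t powr (-2 * \<beta>)) (at t)"
    by (rule DERIV_chain2[OF k(2) \<sigma>[OF t]])
  have p: "t powr a * t powr b = t powr (a + b)" for a b
    by (simp add: powr_add)
  show "(G has_field_derivative G1 t) (at t)"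
    unfolding G_def G1_def
  proof (rule DERIV_cong[OF DERIV_mult[OF has_real_derivative_powr[OF t] 1]])
    have "t powr \<beta> * t powr (-2 * \<beta>) = t powr (- \<beta>)" by (simp add: p)
    then show "\<beta> * t powr (\<beta> - 1) * k (\<sigma> t) + k1 (\<sigma> t) * t powr (- 2 * \<beta>) * t powr \<beta> =
        \<beta> * t powr (\<beta> - 1) * k (\<sigma> t) + t powr (- \<beta>) * k1 (\<sigma> t)"
      by (simp add: mult_ac)
  qed
  show "(G1 has_field_derivative G2 t) (at t)"
    unfolding G_def G1_def G2_def
  proof (rule DERIV_cong[OF DERIV_add[OF DERIV_mult[OF DERIV_cmult[OF has_real_derivative_powr[OF t]] 1]
          DERIV_mult[OF has_real_derivative_powr[OF t] 2]]])
    have e: "t powr (\<beta> - 1) * t powr (-2 * \<beta>) = t powr (- \<beta> - 1)" "t powr (- \<beta>) * t powr (-2 * \<beta>) = t powr (-3 * \<beta>)"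
      "t powr (-2) * t powr \<beta> = t powr (\<beta> - 1 - 1)"
      by (simp_all add: p)
    have "\<beta> * ((\<beta> - 1) * t powr (\<beta> - 1 - 1)) * k (\<sigma> t) + k1 (\<sigma> t) * t powr (- 2 * \<beta>) * (\<beta> * t powr (\<beta> - 1)) +
        (- \<beta> * t powr (- \<beta> - 1) * k1 (\<sigma> t) + k2 (\<sigma> t) * t powr (- 2 * \<beta>) * t powr (- \<beta>)) =
        \<beta> * (\<beta> - 1) * t powr (\<beta> - 1 - 1) * k (\<sigma> t) + \<beta> * (t powr (\<beta> - 1) * t powr (- 2 * \<beta>)) * k1 (\<sigma> t)
        - \<beta> * t powr (- \<beta> - 1) * k1 (\<sigma> t) + (t powr (- \<beta>) * t powr (- 2 * \<beta>)) * k2 (\<sigma> t)"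
      by (simp add: algebra_simps)
    also have "\<dots> = t powr (- 3 * \<beta>) * k2 (\<sigma> t) - \<beta> * (1 - \<beta>) * t powr - 2 * (t powr \<beta> * k (\<sigma> t))"
      unfolding e(1,2) e(3)[symmetric] by (simp add: algebra_simps)
    finally show "\<beta> * ((\<beta> - 1) * t powr (\<beta> - 1 - 1)) * k (\<sigma> t) + k1 (\<sigma> t) * t powr (- 2 * \<beta>) * (\<beta> * t powr (\<beta> - 1)) +
        (- \<beta> * t powr (- \<beta> - 1) * k1 (\<sigma> t) + k2 (\<sigma> t) * t powr (- 2 * \<beta>) * t powr (- \<beta>)) =
        t powr (- 3 * \<beta>) * k2 (\<sigma> t) - \<beta> * (1 - \<beta>) * t powr - 2 * (t powr \<beta> * k (\<sigma> t))" .
  qed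
qed

text \<open>Here \<open>\<rho>\<close> stands for \<open>x \<bullet> x\<close>, so
  \<open>- ln \<rho> / 2\<close> is \<open>- ln (norm x)\<close>. The derivative has the shape of
  the original function with \<open>s - 1\<close> for \<open>s\<close>, so the rule applies again
  for the second derivative.\<close>

lemma DERIV_logarithmic_substitution:
  fixes G :: "real \<Rightarrow> real"
  assumes G: "\<And>t. 0 < t \<Longrightarrow> (G has_field_derivative G1 t) (at t)" and \<rho>: "0 < \<rho>" "\<rho> < 1"
  shows "((\<lambda>\<rho>. \<rho> powr s * G (- ln \<rho> / 2)) has_field_derivative
    \<rho> powr (s - 1) * (s * G (- ln \<rho> / 2) - G1 (- ln \<rho> / 2) / 2)) (at \<rho>)"
proof -
  have "((\<lambda>\<rho>. - ln \<rho> / 2) has_field_derivative (- (\<rho> powr (-1)) / 2)) (at \<rho>)"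
    using \<rho> by (auto intro!: derivative_eq_intros simp: powr_minus_divide)
  from DERIV_chain2[OF G this] \<rho>
  have 1: "((\<lambda>\<rho>. G (- ln \<rho> / 2)) has_field_derivative G1 (- ln \<rho> / 2) * (- (\<rho> powr (-1)) / 2)) (at \<rho>)"
    by simp
  have "\<rho> powr s * \<rho> powr (-1) = \<rho> powr (s - 1)"
    by (rule trans[OF powr_add[symmetric]]) simp
  moreover have "s * r * g + g1 * (- q / 2) * p = r * (s * g - g1 / 2)" if "p * q = r" for p q r g g1 :: real
    unfolding that[symmetric] by (simp add: algebra_simps)
  ultimately show ?thesis
    by (intro DERIV_cong[OF DERIV_mult[OF has_real_derivative_powr[OF \<rho>(1)] 1]])
qed

text \<open>The Hardy ground state as a factor removes the first-order term of the Laplacian in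
  \<open>t = - ln (norm x)\<close>; the factor \<open>t powr \<beta>\<close> and the scale
  \<open>\<sigma>\<close> then absorb the remaining potential, leaving only
  \<open>k2\<close>.\<close>

lemma radial_test_function:
  fixes \<sigma> k :: "real \<Rightarrow> real" and \<beta> a b :: real
  assumes \<sigma>: "\<And>t. 0 < t \<Longrightarrow> (\<sigma> has_field_derivative t powr (-2 * \<beta>)) (at t)"
    and k: "\<And>s. (k has_field_derivative k1 s) (at s)" "\<And>s. (k1 has_field_derivative k2 s) (at s)"
      "\<And>n. Cn_on n k UNIV" "\<And>s. 0 \<le> k s"
      "\<And>s. s \<le> \<sigma> (- ln b) \<Longrightarrow> k s = 0" "\<And>s. \<sigma> (- ln a) \<le> s \<Longrightarrow> k s = 0"
    and ab: "0 < a" "a < b" "b < 1"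
  obtains \<phi> :: "'a::euclidean_space \<Rightarrow> real" where
    "smooth \<phi>" "\<And>x. 0 \<le> \<phi> x" "\<And>x. norm x \<notin> {a..b} \<Longrightarrow> \<phi> x = 0"
    "\<And>x. norm x \<notin> {a..b} \<Longrightarrow> laplacian \<phi> x = 0" "continuous_on UNIV (laplacian \<phi>)"
    "\<And>x. norm x \<in> {a..b} \<Longrightarrow>
       laplacian \<phi> x + (real DIM('a) - 2)\<^sup>2 / 4 * (norm x powr (-2) * \<phi> x) +
         \<beta> * (1 - \<beta>) * (norm x powr (-2) * \<bar>ln (norm x)\<bar> powr (-2) * \<phi> x) =
       norm x powr (-2 - (real DIM('a) - 2) / 2) * \<bar>ln (norm x)\<bar> powr (-3 * \<beta>) * k2 (\<sigma> \<bar>ln (norm x)\<bar>)"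
proof -
  note mono = log_scale_strict_mono[OF \<sigma>]
  \<comment> \<open>As \<open>\<rho>\<close> is the square of the norm, \<open>\<rho> powr s\<close>
    is the ground state \<open>norm x powr (- (N - 2) / 2)\<close>.\<close>
  define s where "s = - (real DIM('a) - 2) / 4"
  define G where "G t = t powr \<beta> * k (\<sigma> t)" for t
  define G1 where "G1 t = \<beta> * t powr (\<beta> - 1) * k (\<sigma> t) + t powr (- \<beta>) * k1 (\<sigma> t)" for t
  define G2 where "G2 t = t powr (-3 * \<beta>) * k2 (\<sigma> t) - \<beta> * (1 - \<beta>) * t powr (-2) * G t" for t
  have G: "(G has_field_derivative G1 t) (at t)" "(G1 has_field_derivative G2 t) (at t)" if "0 < t" for t
    unfolding G2_def G1_def[abs_def] G_def[abs_def]
    using DERIV_ground_state_substitution[OF \<sigma> k(1,2) that] by blast+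
  define H where "H t = s * G t - G1 t / 2" for t
  define H1 where "H1 t = s * G1 t - G2 t / 2" for t
  have H: "(H has_field_derivative H1 t) (at t)" if "0 < t" for t
    unfolding H_def H1_def by (auto intro!: derivative_eq_intros G that)
  \<comment> \<open>The value \<open>0\<close> outside the unit interval fits smoothly, because the
    factor \<open>k\<close> already vanishes for \<open>\<rho>\<close> outside
    \<open>[a\<^sup>2, b\<^sup>2]\<close>.\<close>
  define F where "F \<rho> = (if 0 < \<rho> \<and> \<rho> < 1 then \<rho> powr s * G (- ln \<rho> / 2) else 0)" for \<rho>
  define F1 where "F1 \<rho> = (if 0 < \<rho> \<and> \<rho> < 1 then \<rho> powr (s - 1) * H (- ln \<rho> / 2) else 0)" for \<rho>
  define F2 where "F2 \<rho> = (if 0 < \<rho> \<and> \<rho> < 1 then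
    \<rho> powr (s - 1 - 1) * ((s - 1) * H (- ln \<rho> / 2) - H1 (- ln \<rho> / 2) / 2) else 0)" for \<rho>
  have k1_0: "k1 x = 0" if "x < \<sigma> (- ln b) \<or> \<sigma> (- ln a) < x" for x
    by (rule DERIV_eq_0_of_locally_0[of "{..<\<sigma> (- ln b)} \<union> {\<sigma> (- ln a)<..}" x k]) (use that k in auto)
  have k2_0: "k2 x = 0" if "x < \<sigma> (- ln b) \<or> \<sigma> (- ln a) < x" for x
    by (rule DERIV_eq_0_of_locally_0[of "{..<\<sigma> (- ln b)} \<union> {\<sigma> (- ln a)<..}" x k1]) (use that k k1_0 in auto)
  have off: "\<sigma> (- ln \<rho> / 2) < \<sigma> (- ln b) \<or> \<sigma> (- ln a) < \<sigma> (- ln \<rho> / 2)"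
    if "0 < \<rho>" "\<rho> < 1" "\<rho> \<notin> {a\<^sup>2..b\<^sup>2}" for \<rho>
  proof (cases "\<rho> < a\<^sup>2")
    case True
    then have "ln \<rho> < ln (a\<^sup>2)" using that ab by (subst ln_less_cancel_iff) auto
    then have "ln \<rho> < 2 * ln a" using ab by (simp add: ln_realpow)
    then show ?thesis using that ab by (intro disjI2 mono) auto
  next
    case False
    then have "ln (b\<^sup>2) < ln \<rho>" using that ab by (subst ln_less_cancel_iff) auto
    then have "2 * ln b < ln \<rho>" using ab by (simp add: ln_realpow)
    then show ?thesis using that ab by (intro disjI1 mono) auto
  qed
  have zero: "F \<rho> = 0" "F1 \<rho> = 0" "F2 \<rho> = 0" if "\<rho> \<notin> {a\<^sup>2..b\<^sup>2}" for \<rho>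
    using off[of \<rho>] that k(5,6)[of "\<sigma> (- ln \<rho> / 2)"] k1_0 k2_0
    by (auto simp: F_def F1_def F2_def H_def H1_def G_def G1_def G2_def)
  have b1: "b\<^sup>2 < 1" using ab by (simp add: power_less_one_iff abs_square_less_1)
  have cover: "\<rho> \<in> {0<..<1} \<union> - {a\<^sup>2..b\<^sup>2}" for \<rho>
    using ab b1 by (auto intro: less_le_trans[of 0 "a\<^sup>2"])
  \<comment> \<open>Two open sets cover the line: on the unit interval the formula is
    differentiated, and off \<open>{a\<^sup>2..b\<^sup>2}\<close> everything is zero.\<close>
  have glue: "(f has_field_derivative f' \<rho>) (at \<rho>)"
    if "\<And>\<rho>. \<rho> \<notin> {a\<^sup>2..b\<^sup>2} \<Longrightarrow> f \<rho> = 0" "\<And>\<rho>. \<rho> \<notin> {a\<^sup>2..b\<^sup>2} \<Longrightarrow> f' \<rho> = 0"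
      "\<And>\<rho>. 0 < \<rho> \<Longrightarrow> \<rho> < 1 \<Longrightarrow> (g has_field_derivative f' \<rho>) (at \<rho>)"
      "\<And>\<rho>. 0 < \<rho> \<Longrightarrow> \<rho> < 1 \<Longrightarrow> f \<rho> = g \<rho>" for f f' g :: "real \<Rightarrow> real" and \<rho>
  proof (cases "\<rho> \<in> {a\<^sup>2..b\<^sup>2}")
    case True
    then have "\<rho> \<in> {0<..<1}" using cover[of \<rho>] by auto
    then show ?thesis
      by (intro has_field_derivative_transform_within_open[OF that(3), of \<rho> "{0<..<1}"]) (use that in auto)
  next
    case False
    have "((\<lambda>x. 0) has_field_derivative f' \<rho>) (at \<rho>)" using that(2) False by simp
    then show ?thesis
      by (rule has_field_derivative_transform_within_open[where S="- {a\<^sup>2..b\<^sup>2}"]) (use that False in auto)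
  qed
  have F: "(F has_field_derivative F1 \<rho>) (at \<rho>)" for \<rho>
  proof (rule glue)
    show "((\<lambda>\<rho>. \<rho> powr s * G (- ln \<rho> / 2)) has_field_derivative F1 \<rho>) (at \<rho>)" if "0 < \<rho>" "\<rho> < 1" for \<rho>
      using DERIV_logarithmic_substitution[OF G(1) that, where s=s] that by (simp add: F1_def H_def)
  qed (use zero in \<open>auto simp: F_def\<close>)
  have F1: "(F1 has_field_derivative F2 \<rho>) (at \<rho>)" for \<rho>
  proof (rule glue)
    show "((\<lambda>\<rho>. \<rho> powr (s - 1) * H (- ln \<rho> / 2)) has_field_derivative F2 \<rho>) (at \<rho>)" if "0 < \<rho>" "\<rho> < 1" for \<rho>
      using DERIV_logarithmic_substitution[OF H that, where s="s - 1"] that by (simp add: F2_def)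
  qed (use zero in \<open>auto simp: F1_def\<close>)
  have smooth_F: "Cn_on n F UNIV" for n
  proof -
    have sm: "Cn_on n \<sigma> {0<..}"
      by (rule Cn_on_antiderivative[OF _ _ Cn_on_powr]) (use \<sigma> in auto)
    have "Cn_on n (\<lambda>t. k (\<sigma> t)) {0<..}"
      by (rule Cn_on_compose[OF _ _ k(3) sm]) simp_all
    then have G_smooth: "Cn_on n G {0<..}"
      unfolding G_def[abs_def] by (intro Cn_on_mult Cn_on_powr open_greaterThan)
    have ln_sm: "Cn_on n (\<lambda>\<rho>. (- 1 / 2) * ln \<rho>) {0<..<1}"
      by (intro Cn_on_cmult Cn_on_subset[OF Cn_on_ln]) auto
    have "Cn_on n (\<lambda>\<rho>. G ((- 1 / 2) * ln \<rho>)) {0<..<1}"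
      by (rule Cn_on_compose[OF _ _ G_smooth ln_sm]) auto
    then have "Cn_on n (\<lambda>\<rho>. \<rho> powr s * G ((- 1 / 2) * ln \<rho>)) {0<..<1}"
      by (intro Cn_on_mult Cn_on_subset[OF Cn_on_powr]) auto
    then have 1: "Cn_on n F {0<..<1}"
      by (rule Cn_on_cong[rotated 2]) (auto simp: F_def)
    have 2: "Cn_on n F (- {a\<^sup>2..b\<^sup>2})"
      by (rule Cn_on_cong[rotated 2, OF Cn_on_const[of _ n 0]]) (auto simp: zero)
    have "{0<..<1} \<union> - {a\<^sup>2..b\<^sup>2} = UNIV" using cover by blast
    then show ?thesis using Cn_on_Un[OF _ _ 1 2] by auto
  qed
  have F2: "continuous_on UNIV F2"
  proof -
    have "deriv (deriv F) = F2"
      using DERIV_imp_deriv[OF F] DERIV_imp_deriv[OF F1] by (metis ext)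
    then show ?thesis using smooth_F[of "Suc (Suc 0)"] by simp
  qed
  define \<phi> :: "'a \<Rightarrow> real" where "\<phi> x = F (x \<bullet> x)" for x
  have lap: "laplacian \<phi> x = 2 * DIM('a) * F1 (x \<bullet> x) + 4 * (x \<bullet> x) * F2 (x \<bullet> x)" for x
    unfolding \<phi>_def[abs_def] by (rule laplacian_radial[OF F F1])
  have nin: "x \<bullet> x \<notin> {a\<^sup>2..b\<^sup>2}" if "norm x \<notin> {a..b}" for x :: 'a
    using that ab unfolding dot_square_norm by (auto simp: abs_le_square_iff[symmetric])
  show thesis
  proof (rule that)
    show "smooth \<phi>"
      unfolding smooth_def \<phi>_def[abs_def] using Ck_radial[OF smooth_F] by blast
    show "0 \<le> \<phi> x" for x
      using k(4) by (simp add: \<phi>_def F_def G_def)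
    show "\<phi> x = 0" if "norm x \<notin> {a..b}" for x
      using zero(1) nin[OF that] by (simp add: \<phi>_def)
    show "laplacian \<phi> x = 0" if "norm x \<notin> {a..b}" for x
      using zero(2,3) nin[OF that] by (simp add: lap)
    have F1_cont: "continuous_on UNIV F1"
      using F1 by (auto intro!: continuous_at_imp_continuous_on DERIV_isCont)
    have sq: "continuous_on UNIV (\<lambda>x::'a. x \<bullet> x)"
      by (intro continuous_on_inner continuous_on_id)
    note comp = continuous_on_compose2[OF F1_cont sq subset_UNIV] continuous_on_compose2[OF F2 sq subset_UNIV]
    show "continuous_on UNIV (laplacian \<phi>)"
      unfolding lap[abs_def]
      by (intro continuous_on_add continuous_on_mult continuous_on_const sq comp)
    show "laplacian \<phi> x + (real DIM('a) - 2)\<^sup>2 / 4 * (norm x powr (-2) * \<phi> x) +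
         \<beta> * (1 - \<beta>) * (norm x powr (-2) * \<bar>ln (norm x)\<bar> powr (-2) * \<phi> x) =
       norm x powr (-2 - (real DIM('a) - 2) / 2) * \<bar>ln (norm x)\<bar> powr (-3 * \<beta>) * k2 (\<sigma> \<bar>ln (norm x)\<bar>)"
      if "norm x \<in> {a..b}" for x
    proof -
      define r where "r = norm x"
      define t where "t = - ln r"
      have r: "0 < r" "r < 1" using that ab by (auto simp: r_def)
      have \<rho>: "x \<bullet> x = r\<^sup>2" by (simp add: r_def dot_square_norm)
      have r2: "0 < r\<^sup>2" "r\<^sup>2 < 1" using r by (auto simp: abs_square_less_1)
      have t: "- ln (r\<^sup>2) / 2 = t" using r by (simp add: t_def ln_realpow)
      have p: "r\<^sup>2 powr y = r powr (2 * y)" for y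
        using r by (simp add: powr_powr flip: powr_numeral)
      have "r\<^sup>2 = r powr 2" using r by simp
      then have q: "r\<^sup>2 * r powr (2 * (s - 1 - 1)) = r powr (2 * (s - 1))"
        by (simp add: algebra_simps flip: powr_add)
      have w: "r powr (-2) * r powr (2 * s) = r powr (2 * (s - 1))"
        by (simp add: algebra_simps flip: powr_add)
      have N: "real DIM('a) = 2 - 4 * s" by (simp add: s_def field_simps)
      have "laplacian \<phi> x = 2 * (2 - 4 * s) * (r powr (2 * (s - 1)) * H t) +
          4 * (r\<^sup>2 * r powr (2 * (s - 1 - 1))) * ((s - 1) * H t - H1 t / 2)"
        unfolding lap \<rho> F1_def F2_def t p using r2 N by simp
      \<comment> \<open>The coefficient of \<open>G1 t\<close> is
        \<open>- (2 - 4 * s) - 2 * (s - 1) - 2 * s = 0\<close>, which is the reason for the choice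
        of \<open>s\<close>; the one of \<open>G t\<close> is \<open>- 4 * s\<^sup>2\<close>, minus
        the Hardy constant.\<close>
      also have "\<dots> = r powr (2 * (s - 1)) * (G2 t - 4 * s\<^sup>2 * G t)"
        unfolding q H_def H1_def by (simp add: field_simps power2_eq_square)
      finally have 1: "laplacian \<phi> x = r powr (2 * (s - 1)) * (G2 t - 4 * s\<^sup>2 * G t)" .
      have 2: "r powr (-2) * \<phi> x = r powr (2 * (s - 1)) * G t"
        unfolding \<phi>_def \<rho> F_def t p w[symmetric] using r2 by simp
      have abs: "\<bar>ln r\<bar> = t" using r by (simp add: t_def)
      have 3: "r powr (-2) * t powr (-2) * \<phi> x = r powr (2 * (s - 1)) * (t powr (-2) * G t)"
        using 2 by (simp add: mult_ac)
      have "laplacian \<phi> x + (real DIM('a) - 2)\<^sup>2 / 4 * (r powr (-2) * \<phi> x) +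
          \<beta> * (1 - \<beta>) * (r powr (-2) * t powr (-2) * \<phi> x) =
          r powr (2 * (s - 1)) * (G2 t + \<beta> * (1 - \<beta>) * t powr (-2) * G t)"
        unfolding 1 2 3 N by (simp add: algebra_simps power2_eq_square)
      also have "\<dots> = r powr (-2 - (real DIM('a) - 2) / 2) * t powr (-3 * \<beta>) * k2 (\<sigma> t)"
        by (simp add: G2_def N)
      finally show ?thesis unfolding abs r_def[symmetric] .
    qed
  qed
qed

subsection \<open>Radial integrals\<close>

text \<open>The Jacobian \<open>c ^ DIM('a)\<close> of the dilation cancels against the homogeneity
  of the weight, of degree \<open>- DIM('a)\<close>.\<close>

lemma nn_integral_scale_invariant:
  fixes f :: "'a::euclidean_space \<Rightarrow> ennreal"
  assumes [measurable]: "f \<in> borel_measurable borel" and c: "0 < c"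
  shows "(\<integral>\<^sup>+x. ennreal (norm x powr - real DIM('a)) * f (c *\<^sub>R x) \<partial>lborel) =
    (\<integral>\<^sup>+x. ennreal (norm x powr - real DIM('a)) * f x \<partial>lborel)"
proof -
  have 1: "lborel = density (distr lborel borel (\<lambda>x::'a. 0 + c *\<^sub>R x)) (\<lambda>_. \<bar>c\<bar> ^ DIM('a))"
    using c by (intro lborel_affine) simp
  have 2: "c ^ DIM('a) * norm (c *\<^sub>R x) powr - real DIM('a) = norm x powr - real DIM('a)" for x :: 'a
    using c by (simp add: powr_mult powr_minus powr_realpow flip: powr_realpow)
  have "(\<integral>\<^sup>+x. ennreal (norm x powr - real DIM('a)) * f x \<partial>lborel) =
    (\<integral>\<^sup>+x. ennreal (c ^ DIM('a)) * (ennreal (norm (c *\<^sub>R x) powr - real DIM('a)) * f (c *\<^sub>R x)) \<partial>lborel)"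
    using c by (subst 1) (simp add: nn_integral_density nn_integral_distr)
  also have "\<dots> = (\<integral>\<^sup>+x. ennreal (norm x powr - real DIM('a)) * f (c *\<^sub>R x) \<partial>lborel)"
  proof (rule nn_integral_cong)
    fix x
    show "ennreal (c ^ DIM('a)) * (ennreal (norm (c *\<^sub>R x) powr - real DIM('a)) * f (c *\<^sub>R x)) =
        ennreal (norm x powr - real DIM('a)) * f (c *\<^sub>R x)"
      using c by (subst 2[of x, symmetric]) (simp add: ennreal_mult mult.assoc del: norm_scaleR)
  qed
  finally show ?thesis by simp
qed

text \<open>Polar coordinates for radial functions: averaging the dilation-invariant measure
  \<open>norm x powr - real DIM('a)\<close> over all dilations replaces the polar decomposition of Lebesgue measure.\<close>

lemma nn_integral_radial_log:
  fixes f :: "real \<Rightarrow> ennreal"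
  assumes [measurable]: "f \<in> borel_measurable borel"
  shows "(\<integral>\<^sup>+x. ennreal (norm (x::'a::euclidean_space) powr - real DIM('a)) * f (- ln (norm x)) \<partial>lborel) =
    (\<integral>\<^sup>+x. ennreal (norm (x::'a) powr - real DIM('a)) * indicator {0..<1} (- ln (norm x)) \<partial>lborel) *
    (\<integral>\<^sup>+t. f t \<partial>(lborel :: real measure))" (is "?L = ?M * ?I")
proof -
  define w where "w x = ennreal (norm x powr - real DIM('a))" for x :: 'a
  define T where "T x = - ln (norm x)" for x :: 'a
  define J :: "real \<Rightarrow> ennreal" where "J = indicator {0..<1}"
  have [measurable]: "J \<in> borel_measurable borel" unfolding J_def by measurable
  have [measurable]: "w \<in> borel_measurable borel" "T \<in> borel_measurable borel"
    unfolding w_def[abs_def] T_def[abs_def] by measurable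
  \<comment> \<open>A dilation by \<open>exp s\<close> translates the logarithm by
    \<open>- s\<close>. At the origin, where the logarithm law fails, the weight \<open>w\<close> is
    \<open>0\<close>.\<close>
  have T: "w x * g (T (exp s *\<^sub>R x)) = w x * g (T x - s)" for x s and g :: "real \<Rightarrow> ennreal"
  proof (cases "x = 0")
    case False
    then have "T (exp s *\<^sub>R x) = T x - s" by (simp add: T_def ln_mult)
    then show ?thesis by simp
  qed (simp add: w_def)
  have "?M * ?I = (\<integral>\<^sup>+x. w x * J (T x) * ?I \<partial>lborel)"
    unfolding J_def[symmetric] w_def T_def by (rule nn_integral_multc[symmetric]) measurable
  \<comment> \<open>Translation invariance on the line allows the shift by \<open>T x\<close> in
    \<open>f\<close>. After exchanging the integrals, a dilation in \<open>x\<close> moves the shift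
    from \<open>f\<close> to the window \<open>J\<close>.\<close>
  also have "\<dots> = (\<integral>\<^sup>+x. \<integral>\<^sup>+s. w x * (J (T x) * f (T x + s)) \<partial>lborel \<partial>lborel)"
  proof (rule nn_integral_cong)
    fix x
    have "?I = (\<integral>\<^sup>+s. f (T x + s) \<partial>lborel)"
      using nn_integral_real_affine[of f 1 "T x"] by simp
    then show "w x * J (T x) * ?I = (\<integral>\<^sup>+s. w x * (J (T x) * f (T x + s)) \<partial>lborel)"
      by (simp add: nn_integral_cmult mult.assoc)
  qed
  also have "\<dots> = (\<integral>\<^sup>+s. \<integral>\<^sup>+x. w x * (J (T x) * f (T x + s)) \<partial>lborel \<partial>lborel)"
    by (rule lborel_pair.Fubini'[symmetric]) measurable
  also have "\<dots> = (\<integral>\<^sup>+s. \<integral>\<^sup>+x. w x * (J (T x - s) * f (T x)) \<partial>lborel \<partial>lborel)"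
  proof (rule nn_integral_cong)
    fix s :: real
    have "(\<integral>\<^sup>+x. w x * (J (T x) * f (T x + s)) \<partial>lborel) =
      (\<integral>\<^sup>+x. w x * (J (T (exp s *\<^sub>R x)) * f (T (exp s *\<^sub>R x) + s)) \<partial>lborel)"
    proof -
      have "(\<lambda>x. J (T x) * f (T x + s)) \<in> borel_measurable borel" by measurable
      from nn_integral_scale_invariant[OF this exp_gt_zero, of s] show ?thesis
        unfolding w_def by simp
    qed
    also have "\<dots> = (\<integral>\<^sup>+x. w x * (J (T x - s) * f (T x)) \<partial>lborel)"
      using T[of _ "\<lambda>t. J t * f (t + s)"] by simp
    finally show "(\<integral>\<^sup>+x. w x * (J (T x) * f (T x + s)) \<partial>lborel) =
      (\<integral>\<^sup>+x. w x * (J (T x - s) * f (T x)) \<partial>lborel)" .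
  qed
  also have "\<dots> = (\<integral>\<^sup>+x. \<integral>\<^sup>+s. w x * (J (T x - s) * f (T x)) \<partial>lborel \<partial>lborel)"
    by (rule lborel_pair.Fubini') measurable
  \<comment> \<open>For fixed \<open>x\<close> the window is \<open>1\<close> on an
    \<open>s\<close>-interval of length one, so it integrates out.\<close>
  also have "\<dots> = (\<integral>\<^sup>+x. w x * f (T x) \<partial>lborel)"
  proof (rule nn_integral_cong)
    fix x
    have "(\<integral>\<^sup>+s. w x * (J (T x - s) * f (T x)) \<partial>lborel) =
      (\<integral>\<^sup>+s. (w x * f (T x)) * indicator {T x - 1<..T x} s \<partial>lborel)"
      by (intro nn_integral_cong) (auto simp: J_def indicator_def)
    also have "\<dots> = w x * f (T x)"
      by (subst nn_integral_cmult_indicator) auto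
    finally show "(\<integral>\<^sup>+s. w x * (J (T x - s) * f (T x)) \<partial>lborel) = w x * f (T x)" .
  qed
  finally show ?thesis by (simp add: w_def T_def)
qed

text \<open>Away from the origin the window keeps the norm between \<open>exp (-1)\<close> and
  \<open>1\<close>, where the weight is at most \<open>exp DIM('a)\<close>; at the origin
  \<open>powr\<close> gives weight \<open>0\<close>.\<close>

lemma radial_log_shell_finite:
  "(\<integral>\<^sup>+x. ennreal (norm (x::'a::euclidean_space) powr - real DIM('a)) * indicator {0..<1} (- ln (norm x)) \<partial>lborel) < \<infinity>"
proof -
  have "(\<integral>\<^sup>+x. ennreal (norm (x::'a) powr - real DIM('a)) * indicator {0..<1} (- ln (norm x)) \<partial>lborel) \<le>
    (\<integral>\<^sup>+x. ennreal (exp DIM('a)) * indicator (cball (0::'a) 1) x \<partial>lborel)"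
  proof (rule nn_integral_mono)
    fix x :: 'a
    show "ennreal (norm x powr - real DIM('a)) * indicator {0..<1} (- ln (norm x)) \<le>
      ennreal (exp DIM('a)) * indicator (cball 0 1) x"
    proof (cases "x \<noteq> 0 \<and> - ln (norm x) \<in> {0..<1}")
      case True
      then have "real DIM('a) * (- ln (norm x)) \<le> real DIM('a) * 1"
        by (intro mult_left_mono) auto
      then have "norm x powr - real DIM('a) \<le> exp DIM('a)"
        using True by (simp add: powr_def)
      then show ?thesis using True by (auto simp: ennreal_leI)
    next
      case False
      then show ?thesis by (cases "x = 0") auto
    qed
  qed
  also have "\<dots> = ennreal (exp DIM('a)) * emeasure lborel (cball (0::'a) 1)"
    by (rule nn_integral_cmult_indicator) simp
  also have "\<dots> < \<infinity>"
    using emeasure_lborel_cball_finite[of "0::'a" 1] by (simp add: ennreal_mult_less_top)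
  finally show ?thesis .
qed

subsection \<open>The weak inequality on the logarithmic scale\<close>

text \<open>The radial formula reduces this to the integral of
  \<open>t powr (1 - 4 * \<beta>)\<close>, which is
  \<open>(c0 + (1 - 2 * \<beta>) * \<sigma> t)\<close> times the derivative of
  \<open>\<sigma>\<close>. Its antiderivative is therefore quadratic in \<open>\<sigma>\<close>, and
  this growth is what the width \<open>S\<close> of the tent later compensates.\<close>

lemma integral_log_scale_shell:
  fixes \<sigma> :: "real \<Rightarrow> real" and \<beta> :: real
  assumes \<beta>: "\<beta> \<le> 1/2"
    and \<sigma>: "\<And>t. 0 < t \<Longrightarrow> (\<sigma> has_field_derivative t powr (-2 * \<beta>)) (at t)"
      "\<And>t. 0 < t \<Longrightarrow> t powr (1 - 2 * \<beta>) = c0 + (1 - 2 * \<beta>) * \<sigma> t"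
    and c0: "0 \<le> c0" "c0 \<le> 1"
  defines "h \<equiv> \<lambda>p q (x::'a::euclidean_space). norm x powr - real DIM('a) * \<bar>ln (norm x)\<bar> powr (1 - 4 * \<beta>) *
      indicator {x. norm x \<in> {exp (- q)..exp (- p)}} x"
  obtains K where "0 \<le> K"
    "\<And>p q. 0 < p \<Longrightarrow> p \<le> q \<Longrightarrow> 0 \<le> \<sigma> p \<Longrightarrow> integrable lebesgue (h p q)"
    "\<And>p q. 0 < p \<Longrightarrow> p \<le> q \<Longrightarrow> 0 \<le> \<sigma> p \<Longrightarrow>
      integral\<^sup>L lebesgue (h p q) \<le> K * (\<sigma> q + (1/2 - \<beta>) * (\<sigma> q)\<^sup>2)"
proof -
  define M where
    "M = (\<integral>\<^sup>+x. ennreal (norm (x::'a) powr - real DIM('a)) * indicator {0..<1} (- ln (norm x)) \<partial>lborel)"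
  define K where "K = enn2real M"
  have M: "M = ennreal K"
    using radial_log_shell_finite[where 'a='a] by (simp add: K_def M_def)
  have main: "(\<integral>\<^sup>+x. ennreal (h p q x) \<partial>lborel) \<le> ennreal (K * (\<sigma> q + (1/2 - \<beta>) * (\<sigma> q)\<^sup>2))"
    if pq: "0 < p" "p \<le> q" "0 \<le> \<sigma> p" for p q
  proof -
    define f where "f t = ennreal (t powr (1 - 4 * \<beta>)) * indicator {p..q} t" for t
    have [measurable]: "f \<in> borel_measurable borel" unfolding f_def[abs_def] by measurable
    define H where "H t = c0 * \<sigma> t + (1/2 - \<beta>) * (\<sigma> t)\<^sup>2" for t
    have "\<sigma> p \<le> \<sigma> q"
      using log_scale_strict_mono[of \<sigma> \<beta> p q, OF \<sigma>(1)] pq by (cases "p = q") auto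
    then have q: "0 \<le> \<sigma> q" using pq by simp
    have "(\<integral>\<^sup>+t. f t \<partial>lborel) = ennreal (H q - H p)"
      unfolding f_def
    proof (rule nn_integral_FTC_Icc[OF _ _ _ pq(2)])
      fix t assume "t \<in> {p..q}"
      then have t: "0 < t" using pq by simp
      have "t powr (1 - 4 * \<beta>) = t powr (1 - 2 * \<beta>) * t powr (-2 * \<beta>)"
        by (simp flip: powr_add)
      also have "\<dots> = (c0 + (1 - 2 * \<beta>) * \<sigma> t) * t powr (-2 * \<beta>)"
        using \<sigma>(2)[OF t] by simp
      finally have e: "t powr (1 - 4 * \<beta>) = (c0 + (1 - 2 * \<beta>) * \<sigma> t) * t powr (-2 * \<beta>)" .
      show "(H has_real_derivative t powr (1 - 4 * \<beta>)) (at t)"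
        unfolding H_def[abs_def] e by (auto intro!: derivative_eq_intros \<sigma>(1)[OF t] simp: field_simps)
    qed auto
    also have "H q - H p \<le> \<sigma> q + (1/2 - \<beta>) * (\<sigma> q)\<^sup>2"
    proof -
      have "c0 * \<sigma> q \<le> 1 * \<sigma> q" using c0 q by (intro mult_right_mono)
      moreover have "0 \<le> c0 * \<sigma> p" "0 \<le> (1/2 - \<beta>) * (\<sigma> p)\<^sup>2"
        using c0 pq \<beta> by simp_all
      ultimately show ?thesis unfolding H_def by simp
    qed
    finally have I: "(\<integral>\<^sup>+t. f t \<partial>lborel) \<le> ennreal (\<sigma> q + (1/2 - \<beta>) * (\<sigma> q)\<^sup>2)"
      by (simp add: ennreal_leI)
    have "(\<integral>\<^sup>+x. ennreal (h p q x) \<partial>lborel) \<le>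
      (\<integral>\<^sup>+x. ennreal (norm (x::'a) powr - real DIM('a)) * f (- ln (norm x)) \<partial>lborel)"
    proof (rule nn_integral_mono)
      fix x :: 'a
      show "ennreal (h p q x) \<le> ennreal (norm x powr - real DIM('a)) * f (- ln (norm x))"
      proof (cases "norm x \<in> {exp (- q)..exp (- p)}")
        case True
        then have n: "0 < norm x" using exp_gt_zero[of "- q"] by (auto intro: less_le_trans simp del: zero_less_norm_iff exp_gt_zero)
        have "ln (exp (- q)) \<le> ln (norm x)" "ln (norm x) \<le> ln (exp (- p))"
          using True n by (subst ln_le_cancel_iff; simp)+
        then show ?thesis using pq True by (simp add: h_def f_def ennreal_mult)
      qed (simp add: h_def)
    qed
    also have "\<dots> = M * (\<integral>\<^sup>+t. f t \<partial>lborel)"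
      unfolding M_def by (rule nn_integral_radial_log) measurable
    also have "\<dots> \<le> M * ennreal (\<sigma> q + (1/2 - \<beta>) * (\<sigma> q)\<^sup>2)"
      by (rule mult_left_mono[OF I]) simp
    also have "\<dots> = ennreal (K * (\<sigma> q + (1/2 - \<beta>) * (\<sigma> q)\<^sup>2))"
      unfolding M using q \<beta> by (intro ennreal_mult[symmetric]) (auto simp: K_def)
    finally show ?thesis .
  qed
  have meas: "h p q \<in> borel_measurable borel" for p q
    unfolding h_def by measurable
  have nonneg: "0 \<le> h p q x" for p q x by (simp add: h_def)
  have int: "integrable lborel (h p q)" if "0 < p" "p \<le> q" "0 \<le> \<sigma> p" for p q
    using main[OF that] meas[of p q] nonneg[of p q]
    by (intro integrableI_bounded) (auto intro: le_less_trans)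
  show thesis
  proof (rule that)
    show "0 \<le> K" by (simp add: K_def)
    show "integrable lebesgue (h p q)" if "0 < p" "p \<le> q" "0 \<le> \<sigma> p" for p q
      using int[OF that] by (simp add: integrable_completion)
    show "integral\<^sup>L lebesgue (h p q) \<le> K * (\<sigma> q + (1/2 - \<beta>) * (\<sigma> q)\<^sup>2)"
      if pq: "0 < p" "p \<le> q" "0 \<le> \<sigma> p" for p q
    proof -
      have "\<sigma> p \<le> \<sigma> q"
        using log_scale_strict_mono[of \<sigma> \<beta> p q, OF \<sigma>(1)] pq by (cases "p = q") auto
      then have q: "0 \<le> K * (\<sigma> q + (1/2 - \<beta>) * (\<sigma> q)\<^sup>2)" using pq \<beta> by (simp add: K_def)
      have "ennreal (integral\<^sup>L lborel (h p q)) \<le> ennreal (K * (\<sigma> q + (1/2 - \<beta>) * (\<sigma> q)\<^sup>2))"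
        using main[OF pq] nn_integral_eq_integral[OF int[OF pq]] nonneg by simp
      then show ?thesis
        using meas q by (simp add: integral_completion ennreal_le_iff)
    qed
  qed
qed

lemma set_integrable_mult_continuous:
  fixes u h :: "'a::euclidean_space \<Rightarrow> real"
  assumes "compact A" "set_integrable lebesgue A u" "continuous_on A h"
  shows "set_integrable lebesgue A (\<lambda>x. u x * h x)"
proof -
  obtain C where C: "\<And>x. x \<in> A \<Longrightarrow> \<bar>h x\<bar> \<le> C"
    using compact_imp_bounded[OF compact_continuous_image[OF assms(3,1)]] by (auto simp: bounded_iff)
  have "(\<lambda>x. indicator A x *\<^sub>R h x) \<in> borel_measurable borel"
    using assms by (intro borel_measurable_continuous_on_indicator) (auto simp: compact_imp_closed)
  then have [measurable]: "(\<lambda>x. indicator A x *\<^sub>R h x) \<in> borel_measurable lebesgue"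
    by (intro measurable_completion) simp
  have [measurable]: "(\<lambda>x. indicator A x *\<^sub>R u x) \<in> borel_measurable lebesgue"
    using assms(2) unfolding set_integrable_def by (rule borel_measurable_integrable)
  have *: "(\<lambda>x. indicator A x *\<^sub>R (u x * h x)) = (\<lambda>x. (indicator A x *\<^sub>R u x) * (indicator A x *\<^sub>R h x))"
    by (auto simp: fun_eq_iff indicator_def)
  have "integrable lebesgue (\<lambda>x. C * (indicator A x *\<^sub>R u x))"
    using assms(2) unfolding set_integrable_def by (intro integrable_mult_right) auto
  then show ?thesis
    unfolding set_integrable_def
  proof (rule Bochner_Integration.integrable_bound)
    show "(\<lambda>x. indicator A x *\<^sub>R (u x * h x)) \<in> borel_measurable lebesgue"
      unfolding * by measurable
    have "\<bar>u x\<bar> * \<bar>h x\<bar> \<le> \<bar>C\<bar> * \<bar>u x\<bar>" if "x \<in> A" for x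
      using mult_right_mono[of "\<bar>h x\<bar>" "\<bar>C\<bar>" "\<bar>u x\<bar>"] C[OF that] by (simp add: mult.commute)
    then show "AE x in lebesgue. norm (indicator A x *\<^sub>R (u x * h x)) \<le> norm (C * (indicator A x *\<^sub>R u x))"
      by (auto simp: abs_mult indicator_def)
  qed
qed

text \<open>With the radial test function the integrand collapses to \<open>k2\<close>.
  Nonnegativity of \<open>u\<close> and of the test function allows lowering \<open>\<alpha>\<close>
  to \<open>\<beta> * (1 - \<beta>)\<close>, the value for which the cancellation is exact.\<close>

lemma solution_inequality_log_scale:
  fixes u :: "real ^ 'n \<Rightarrow> real" and \<sigma> k :: "real \<Rightarrow> real"
  assumes R: "R \<le> 1" and u: "AE x\<in>ball 0 R in lebesgue. 0 \<le> u x" "distributional_solution R \<alpha> u"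
    and \<alpha>: "\<beta> * (1 - \<beta>) \<le> \<alpha>"
    and \<sigma>: "\<And>t. 0 < t \<Longrightarrow> (\<sigma> has_field_derivative t powr (-2 * \<beta>)) (at t)"
    and k: "\<And>s. (k has_field_derivative k1 s) (at s)" "\<And>s. (k1 has_field_derivative k2 s) (at s)"
      "\<And>n. Cn_on n k UNIV" "\<And>s. 0 \<le> k s"
      "\<And>s. s \<le> \<sigma> (- ln b) \<Longrightarrow> k s = 0" "\<And>s. \<sigma> (- ln a) \<le> s \<Longrightarrow> k s = 0"
    and ab: "0 < a" "a < b" "b < R"
  defines "A \<equiv> {x. norm x \<in> {a..b}}"
  shows "(LINT x:A|lebesgue. u x * (norm x powr (-2 - (real CARD('n) - 2) / 2) * \<bar>ln (norm x)\<bar> powr (-3 * \<beta>)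
    * k2 (\<sigma> \<bar>ln (norm x)\<bar>))) \<le> 0"
proof -
  define w where "w x = norm x powr (-2)" for x :: "real ^ 'n"
  define l where "l x = \<bar>ln (norm x)\<bar> powr (-2)" for x :: "real ^ 'n"
  define c where "c = (real CARD('n) - 2)\<^sup>2 / 4"
  have b1: "b < 1" using ab R by simp
  obtain \<phi> :: "real ^ 'n \<Rightarrow> real" where \<phi>: "smooth \<phi>" "\<And>x. 0 \<le> \<phi> x" "\<And>x. norm x \<notin> {a..b} \<Longrightarrow> \<phi> x = 0"
    "\<And>x. norm x \<notin> {a..b} \<Longrightarrow> laplacian \<phi> x = 0" "continuous_on UNIV (laplacian \<phi>)"
    and eq: "\<And>x. norm x \<in> {a..b} \<Longrightarrow>
       laplacian \<phi> x + c * (w x * \<phi> x) + \<beta> * (1 - \<beta>) * (w x * l x * \<phi> x) =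
       norm x powr (-2 - (real CARD('n) - 2) / 2) * \<bar>ln (norm x)\<bar> powr (-3 * \<beta>) * k2 (\<sigma> \<bar>ln (norm x)\<bar>)"
    using radial_test_function[where 'a="real ^ 'n", OF \<sigma> k ab(1,2) b1]
    unfolding c_def w_def l_def DIM_cart DIM_real mult_1_right by blast
  have A: "compact A" "A \<subseteq> ball 0 R - {0}"
  proof -
    have "A = cball 0 b \<inter> (\<lambda>x. norm x) -` {a..}" by (auto simp: A_def)
    moreover have "closed ((\<lambda>x::real ^ 'n. norm x) -` {a..})"
      by (intro closed_vimage continuous_on_norm continuous_on_id) auto
    ultimately show "compact A" by (simp add: compact_Int_closed)
    show "A \<subseteq> ball 0 R - {0}" using ab by (auto simp: A_def)
  qed
  have sub: "closure {x. \<phi> x \<noteq> 0} \<subseteq> A"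
    using \<phi>(3) by (intro closure_minimal compact_imp_closed A) (auto simp: A_def)
  have "compact (closure {x. \<phi> x \<noteq> 0})"
    using compact_Int_closed[OF A(1), of "closure {x. \<phi> x \<noteq> 0}"] sub by (simp add: Int_absorb1)
  then have test: "\<phi> \<in> test_functions (ball 0 R - {0})"
    using \<phi>(1) sub A(2) by (auto simp: test_functions_def)
  have uA: "set_integrable lebesgue A u"
    using u(2) A by (auto simp: distributional_solution_def L1_loc_def)
  have \<phi>_cont: "continuous_on A \<phi>"
    using \<phi>(1) continuous_on_subset[of UNIV \<phi> A] unfolding smooth_def by (metis Ck.simps(1) subset_UNIV)
  have nz: "norm x \<noteq> 0" "ln (norm x) \<noteq> 0" if "x \<in> A" for x
  proof -
    have "0 < norm x" "norm x < 1" using that ab b1 by (auto simp: A_def)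
    then show "norm x \<noteq> 0" "ln (norm x) \<noteq> 0" using ln_less_zero[of "norm x"] by linarith+
  qed
  have w_cont: "continuous_on A w" "continuous_on A l"
    unfolding w_def l_def by (intro continuous_intros; use nz in auto)+
  have int: "set_integrable lebesgue A (\<lambda>x. u x * laplacian \<phi> x)" "set_integrable lebesgue A (\<lambda>x. u x * (w x * \<phi> x))"
    "set_integrable lebesgue A (\<lambda>x. u x * (w x * l x * \<phi> x))"
    by (intro set_integrable_mult_continuous A uA continuous_on_mult w_cont \<phi>_cont continuous_on_subset[OF \<phi>(5)] subset_UNIV)+
  \<comment> \<open>On the compact annulus \<open>A\<close> the function \<open>u\<close> is
    integrable and all other factors are continuous, so the integrals can be combined there.\<close>
  have restrict: "(LINT x:ball 0 R|lebesgue. f x) = (LINT x:A|lebesgue. f x)" if "\<And>x. x \<notin> A \<Longrightarrow> f x = 0" for f :: "real ^ 'n \<Rightarrow> real"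
    unfolding set_lebesgue_integral_def
    by (intro Bochner_Integration.integral_cong) (use that A(2) in \<open>auto simp: indicator_def\<close>)
  have r: "(LINT x:ball 0 R|lebesgue. u x * laplacian \<phi> x) = (LINT x:A|lebesgue. u x * laplacian \<phi> x)"
    "(LINT x:ball 0 R|lebesgue. w x * u x * \<phi> x) = (LINT x:A|lebesgue. u x * (w x * \<phi> x))"
    "(LINT x:ball 0 R|lebesgue. w x * l x * u x * \<phi> x) = (LINT x:A|lebesgue. u x * (w x * l x * \<phi> x))"
    by (subst restrict; use \<phi>(3,4) in \<open>auto simp: A_def mult_ac\<close>)+
  have "\<alpha> * (LINT x:ball 0 R|lebesgue. w x * l x * u x * \<phi> x) \<le>
      - (LINT x:ball 0 R|lebesgue. u x * laplacian \<phi> x) - c * (LINT x:ball 0 R|lebesgue. w x * u x * \<phi> x)"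
    using u(2) test \<phi>(2) unfolding distributional_solution_def w_def l_def c_def by blast
  then have ineq: "(LINT x:A|lebesgue. u x * laplacian \<phi> x) + c * (LINT x:A|lebesgue. u x * (w x * \<phi> x)) +
      \<alpha> * (LINT x:A|lebesgue. u x * (w x * l x * \<phi> x)) \<le> 0"
    unfolding r by simp
  have "0 \<le> (LINT x:A|lebesgue. u x * (w x * l x * \<phi> x))"
    unfolding set_lebesgue_integral_def
  proof (rule integral_nonneg_AE)
    show "AE x in lebesgue. 0 \<le> indicator A x *\<^sub>R (u x * (w x * l x * \<phi> x))"
      using u(1) by eventually_elim (use A(2) \<phi>(2) in \<open>auto simp: indicator_def w_def l_def\<close>)
  qed
  from mult_right_mono[OF \<alpha> this] ineq
  have "(LINT x:A|lebesgue. u x * laplacian \<phi> x) + c * (LINT x:A|lebesgue. u x * (w x * \<phi> x)) +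
      \<beta> * (1 - \<beta>) * (LINT x:A|lebesgue. u x * (w x * l x * \<phi> x)) \<le> 0"
    by simp
  also have "(LINT x:A|lebesgue. u x * laplacian \<phi> x) + c * (LINT x:A|lebesgue. u x * (w x * \<phi> x)) +
      \<beta> * (1 - \<beta>) * (LINT x:A|lebesgue. u x * (w x * l x * \<phi> x)) =
      (LINT x:A|lebesgue. u x * laplacian \<phi> x + c * (u x * (w x * \<phi> x)) + \<beta> * (1 - \<beta>) * (u x * (w x * l x * \<phi> x)))"
    using int by (simp add: set_integral_add)
  also have "\<dots> = (LINT x:A|lebesgue. u x * (norm x powr (-2 - (real CARD('n) - 2) / 2) * \<bar>ln (norm x)\<bar> powr (-3 * \<beta>)
    * k2 (\<sigma> \<bar>ln (norm x)\<bar>)))"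
  proof -
    have "u x * laplacian \<phi> x + c * (u x * (w x * \<phi> x)) + \<beta> * (1 - \<beta>) * (u x * (w x * l x * \<phi> x)) =
        u x * (laplacian \<phi> x + c * (w x * \<phi> x) + \<beta> * (1 - \<beta>) * (w x * l x * \<phi> x))" for x
      by (simp add: algebra_simps)
    then show ?thesis
      unfolding set_lebesgue_integral_def
      by (intro Bochner_Integration.integral_cong refl) (simp add: indicator_def A_def eq)
  qed
  finally show ?thesis .
qed

lemma weighted_L2_imp_set_integrable:
  fixes u \<omega> :: "'a::euclidean_space \<Rightarrow> real"
  assumes "u \<in> weighted_L2 \<Omega> \<omega>" "\<omega> \<in> borel_measurable borel" "\<And>x. 0 \<le> \<omega> x" "\<Omega> \<in> sets borel"
  shows "set_integrable lebesgue \<Omega> (\<lambda>x. (u x)\<^sup>2 * \<omega> x)"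
proof -
  have [measurable]: "u \<in> borel_measurable (lebesgue_on \<Omega>)"
    using assms(1) by (simp add: weighted_L2_def)
  have "\<omega> \<in> borel_measurable lebesgue"
    using assms(2) by (intro measurable_completion) simp
  then have [measurable]: "\<omega> \<in> borel_measurable (lebesgue_on \<Omega>)"
    by (rule measurable_restrict_space1)
  have "integrable (lebesgue_on \<Omega>) (\<lambda>x. (u x)\<^sup>2 * \<omega> x)"
    using assms(1,3) by (intro integrableI_bounded) (simp_all add: weighted_L2_def abs_mult)
  then show ?thesis
    using assms(4) by (simp add: set_integrable_def integrable_restrict_space)
qed

section \<open>Vanishing on annuli and exhaustion of the ball\<close>

text \<open>\<open>J\<close> tests \<open>u\<close> against a weight that is positive on the open
  annulus, so it suffices to show \<open>J \<le> 0\<close>. The tents keep their first corner over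
  this annulus while the other two move towards the origin.\<close>

lemma solution_vanishes_on_annulus:
  fixes u :: "real ^ 'n \<Rightarrow> real"
  assumes R: "R \<le> 1" and u: "AE x\<in>ball 0 R in lebesgue. 0 \<le> u x" "distributional_solution R \<alpha> u"
    and \<gamma>: "\<gamma> \<le> 1" "\<alpha> \<ge> 1 / 4 - (1 - \<gamma>)\<^sup>2"
    and L2: "u \<in> weighted_L2_loc_ball R (\<lambda>x. norm x powr (-2) * \<bar>ln (norm x)\<bar> powr (-2 * \<gamma>))"
    and ab: "0 < a" "a < b" "b < R"
  shows "AE x in lebesgue. a < norm x \<and> norm x < b \<longrightarrow> u x = 0"
proof -
  define \<beta> where "\<beta> = \<gamma> - 1 / 2"
  have \<beta>: "\<beta> \<le> 1/2" using \<gamma> by (simp add: \<beta>_def)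
  have \<alpha>: "\<beta> * (1 - \<beta>) \<le> \<alpha>"
  proof -
    have "\<beta> * (1 - \<beta>) = 1 / 4 - (1 - \<gamma>)\<^sup>2"
      by (simp add: \<beta>_def power2_eq_square field_simps)
    then show ?thesis using \<gamma>(2) by simp
  qed
  obtain \<sigma> c0 where \<sigma>: "\<And>t. 0 < t \<Longrightarrow> (\<sigma> has_field_derivative t powr (-2 * \<beta>)) (at t)"
    "\<And>s. 0 < s \<Longrightarrow> \<exists>t>0. \<sigma> t = s" "0 \<le> c0" "c0 \<le> 1"
    "\<And>t. 0 < t \<Longrightarrow> t powr (1 - 2 * \<beta>) = c0 + (1 - 2 * \<beta>) * \<sigma> t"
    using log_scale[OF \<beta>] by blast
  have mono: "\<sigma> s < \<sigma> t" if "0 < s" "s < t" for s t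
    by (rule log_scale_strict_mono[OF \<sigma>(1)]) (use that in auto)
  have mono_iff: "\<sigma> s < \<sigma> t \<longleftrightarrow> s < t" if "0 < s" "0 < t" for s t
    using mono[of s t] mono[of t s] that by (cases s t rule: linorder_cases) auto
  have b1: "b < 1" using ab R by simp
  define N where "N = real CARD('n)"
  define t where "t x = \<bar>ln (norm x)\<bar>" for x :: "real ^ 'n"
  have t: "t x = - ln (norm x)" "0 < t x" "exp (- t x) = norm x" if "0 < norm x" "norm x < 1" for x
    using that ln_less_zero[of "norm x"] by (auto simp: t_def)
  define W where "W x = norm x powr (-2 - (N - 2) / 2) * t x powr (-3 * \<beta>)" for x
  \<comment> \<open>The contribution to the tested inequality of a corner with centre
    \<open>s\<close> and width \<open>w\<close>.\<close>
  define D where "D s w x = u x * (W x * (bump ((\<sigma> (t x) - s) / w) / w))" for s w x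
  define A where "A r = {x :: real ^ 'n. norm x \<in> {r..b}}" for r
  \<comment> \<open>Centre and half-width of the image of the annulus under \<open>\<sigma>\<close>,
    so that the first corner of every tent lies exactly over it.\<close>
  define c where "c = (\<sigma> (- ln b) + \<sigma> (- ln a)) / 2"
  define e where "e = (\<sigma> (- ln a) - \<sigma> (- ln b)) / 2"
  have lnab: "0 < - ln b" "- ln b < - ln a" using ab b1 by auto
  have e: "0 < e" using mono[OF lnab] by (simp add: e_def)
  have c_e: "\<sigma> (- ln b) = c - e" "\<sigma> (- ln a) = c + e" by (simp_all add: c_def e_def field_simps)
  have in_A: "0 < norm x" "norm x < 1" "x \<in> ball 0 R" if "x \<in> A r" "0 < r" for x r
    using that ab b1 by (auto simp: A_def)
  have W_nonneg: "0 \<le> W x" for x by (simp add: W_def)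
  have compact_A: "compact (A r)" for r
  proof -
    have "A r = cball 0 b \<inter> (\<lambda>x. norm x) -` {r..}" by (auto simp: A_def)
    moreover have "closed ((\<lambda>x::real ^ 'n. norm x) -` {r..})"
      by (intro closed_vimage continuous_on_norm continuous_on_id) auto
    ultimately show ?thesis by (simp add: compact_Int_closed)
  qed
  have int_D: "set_integrable lebesgue (A r) (D s w)" if r: "0 < r" for r s w
  proof -
    have "A r \<subseteq> ball 0 R - {0}" using in_A[OF _ r] by fastforce
    then have "set_integrable lebesgue (A r) u"
      using u(2) compact_A by (auto simp: distributional_solution_def L1_loc_def)
    moreover have t_cont: "continuous_on (A r) t"
      unfolding t_def using in_A(1)[OF _ r] by (intro continuous_intros) auto
    moreover have "continuous_on {0<..} \<sigma>"
      using \<sigma>(1) by (intro continuous_at_imp_continuous_on) (auto intro: DERIV_isCont)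
    then have "continuous_on (A r) (\<lambda>x. \<sigma> (t x))"
      by (rule continuous_on_compose2[OF _ t_cont]) (use in_A[OF _ r] t(2) in auto)
    then have q: "continuous_on (A r) (\<lambda>x. (1 / w) * (\<sigma> (t x) - s))"
      by (intro continuous_on_mult continuous_on_diff continuous_on_const)
    have "continuous_on (A r) (\<lambda>x. bump ((1 / w) * (\<sigma> (t x) - s)) * (1 / w))"
      by (intro continuous_on_mult continuous_on_const continuous_on_compose2[OF continuous_on_bump q subset_UNIV])
    moreover have "continuous_on (A r) W"
      unfolding W_def using in_A[OF _ r] t(2) by (intro continuous_on_mult continuous_on_powr continuous_on_norm
          continuous_on_id continuous_on_const t_cont) fastforce+
    ultimately show ?thesis
      unfolding D_def
      by (intro set_integrable_mult_continuous compact_A continuous_on_mult) (simp_all add: mult.commute)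
  qed
  have D_nonneg: "AE x in lebesgue. x \<in> A r \<longrightarrow> 0 \<le> D s w x" if "0 < r" "0 < w" for r s w
    using u(1) by eventually_elim (use in_A(3) that W_nonneg bump_nonneg in \<open>auto simp: D_def\<close>)
  define J where "J = (LINT x:A a|lebesgue. D c e x)"
  \<comment> \<open>Local weighted integrability gives finiteness only on balls smaller than
    \<open>ball 0 R\<close>; this one still contains every annulus \<open>A r\<close>.\<close>
  define R' where "R' = (b + R) / 2"
  have R': "0 < R'" "R' < R" "b < R'" using ab by (auto simp: R'_def)
  define f where "f x = (u x)\<^sup>2 * (norm x powr (-2) * t x powr (-2 * \<gamma>))" for x
  have f_int: "set_integrable lebesgue (ball 0 R') f"
    unfolding f_def t_def
    by (rule weighted_L2_imp_set_integrable) (use L2 R' in \<open>auto simp: weighted_L2_loc_ball_def\<close>)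
  have f_nonneg: "0 \<le> f x" for x by (simp add: f_def)
  define g where "g p q x = norm x powr - N * t x powr (1 - 4 * \<beta>) *
      indicator {x. norm x \<in> {exp (- q)..exp (- p)}} x" for p q :: real and x :: "real ^ 'n"
  obtain K0 where K0: "0 \<le> K0"
    "\<And>p q. 0 < p \<Longrightarrow> p \<le> q \<Longrightarrow> 0 \<le> \<sigma> p \<Longrightarrow> integrable lebesgue (g p q)"
    "\<And>p q. 0 < p \<Longrightarrow> p \<le> q \<Longrightarrow> 0 \<le> \<sigma> p \<Longrightarrow>
      integral\<^sup>L lebesgue (g p q) \<le> K0 * (\<sigma> q + (1/2 - \<beta>) * (\<sigma> q)\<^sup>2)"
    using integral_log_scale_shell[where 'a="real ^ 'n", OF \<beta> \<sigma>(1,5,3,4)]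
    unfolding g_def[abs_def] t_def N_def DIM_cart DIM_real mult_1_right by blast
  \<comment> \<open>The numbers anticipate \<open>\<sigma> q = c + 4 * S \<le> 5 * S\<close>
    together with \<open>1 \<le> S\<close>.\<close>
  define K where "K = K0 * (5 + 25 * (1/2 - \<beta>))"
  have K: "0 \<le> K" using K0(1) \<beta> by (simp add: K_def)
  \<comment> \<open>The value of \<open>t\<close> at which the concave corner of the tent of size
    \<open>n\<close> begins, meaningful from \<open>n0\<close> on. \<open>F n\<close> keeps the
    weighted square of \<open>u\<close> from there to the origin.\<close>
  define p where "p n = (SOME t. 0 < t \<and> \<sigma> t = c + 2 * real n)" for n
  define F where "F n x = indicator (cball 0 (exp (- p n))) x * (indicator (ball 0 R') x *\<^sub>R f x)" for n x
  \<comment> \<open>One threshold secures all size conditions: \<open>S\<close> dominates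
    \<open>1\<close> and \<open>e\<close>, and \<open>c + S\<close> is positive.\<close>
  obtain n0 :: nat where n0: "1 + \<bar>c\<bar> + e \<le> real n0" using real_arch_simple by blast
  have n0_le: "1 + \<bar>c\<bar> + e \<le> real n" if "n0 \<le> n" for n
    using n0 that by (meson of_nat_mono order_trans)
  have p: "0 < p n" "\<sigma> (p n) = c + 2 * real n" if "n0 \<le> n" for n
  proof -
    have "0 < c + 2 * real n" using n0_le[OF that] e by linarith
    then have "0 < p n \<and> \<sigma> (p n) = c + 2 * real n"
      unfolding p_def using someI_ex[OF \<sigma>(2)] by blast
    then show "0 < p n" "\<sigma> (p n) = c + 2 * real n" by auto
  qed
  have F_int: "integrable lebesgue (F n)" for n
    unfolding F_def using f_int
    by (intro integrable_mult_indicator[where 'b=real, simplified]) (auto simp: set_integrable_def)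
  \<comment> \<open>As \<open>\<sigma> (p n)\<close> is unbounded, every point other than the origin
    leaves the shrinking balls, and at the origin \<open>f\<close> is \<open>0\<close>. The
    integrable majorant is \<open>f\<close> on \<open>ball 0 R'\<close>.\<close>
  have F_tendsto: "(\<lambda>n. integral\<^sup>L lebesgue (F n)) \<longlonglongrightarrow> 0"
  proof -
    have "(\<lambda>n. integral\<^sup>L lebesgue (F n)) \<longlonglongrightarrow> integral\<^sup>L lebesgue (\<lambda>x :: real ^ 'n. 0 :: real)"
    proof (rule integral_dominated_convergence)
      show "integrable lebesgue (\<lambda>x. indicator (ball 0 R') x *\<^sub>R f x)"
        using f_int by (simp add: set_integrable_def)
      show "AE x in lebesgue. (\<lambda>n. F n x) \<longlonglongrightarrow> 0"
      proof (intro AE_I2 tendsto_eventually)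
        fix x :: "real ^ 'n"
        show "\<forall>\<^sub>F n in sequentially. F n x = 0"
        proof (cases "x \<in> ball 0 R' \<and> x \<noteq> 0")
          case True
          then have x: "0 < norm x" "norm x < 1" using R R' by auto
          obtain n1 :: nat where n1: "(\<sigma> (t x) - c) / 2 < real n1" using reals_Archimedean2 by blast
          show ?thesis
            unfolding eventually_sequentially
          proof (intro exI[of _ "max n0 n1"] allI impI)
            fix n assume n: "max n0 n1 \<le> n"
            then have "real n1 \<le> real n" by simp
            then have "\<sigma> (t x) < \<sigma> (p n)" using p(2)[of n] n n1 by simp
            then have "t x < p n" using mono_iff t(2)[OF x] p(1)[of n] n by simp
            then have "exp (- p n) < norm x" using t(3)[OF x] by (metis exp_less_mono neg_less_iff_less)
            then show "F n x = 0" by (simp add: F_def)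
          qed
        next
          case False
          then show ?thesis by (cases "x = 0") (auto simp: F_def f_def)
        qed
      qed
      show "AE x in lebesgue. norm (F n x) \<le> indicator (ball 0 R') x *\<^sub>R f x" for n
        using f_nonneg by (auto simp: F_def indicator_def)
    qed (use F_int in \<open>auto intro: borel_measurable_integrable\<close>)
    then show ?thesis by simp
  qed
  have J_le: "J \<le> \<eta> * integral\<^sup>L lebesgue (F n) + K / \<eta>" if \<eta>: "0 < \<eta>" and n: "n0 \<le> n" for \<eta> :: real and n
  proof -
    define S where "S = real n"
    have S: "1 \<le> S" "e \<le> S" "0 < c + S" "c \<le> S" "0 < S"
      using n0_le[OF n] e by (auto simp: S_def)
    obtain q where q: "0 < q" "\<sigma> q = c + 4 * S" using \<sigma>(2)[of "c + 4 * S"] S by auto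
    \<comment> \<open>The tent ends at \<open>r\<close>, so its test function lives on the annulus
      from \<open>exp (- r)\<close> to \<open>b\<close>.\<close>
    obtain r where r: "0 < r" "\<sigma> r = c + 7 * S" using \<sigma>(2)[of "c + 7 * S"] S by auto
    have pn: "0 < p n" "\<sigma> (p n) = c + 2 * S" using p[OF n] by (auto simp: S_def)
    have pq: "p n \<le> q" using mono_iff[OF pn(1) q(1)] pn q S by simp
    have "- ln b < r" using mono_iff[of "- ln b" r] lnab r c_e e S by simp
    then have "exp (- r) < exp (ln b)" by simp
    then have rb: "exp (- r) < b" using ab by simp
    have "\<not> r < - ln a" using mono_iff[of r "- ln a"] lnab r c_e e S by simp
    then have "exp (- r) \<le> exp (ln a)" by simp
    then have ra: "exp (- r) \<le> a" using ab by simp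
    obtain k k1 where k: "\<And>s. (k has_field_derivative k1 s) (at s)"
      "\<And>s. (k1 has_field_derivative bump ((s - c) / e) / e - 2 * bump ((s - (c + 3 * S)) / S) / S
         + bump ((s - (c + 6 * S)) / S) / S) (at s)"
      "\<And>n. Cn_on n k UNIV" "\<And>s. 0 \<le> k s" "\<And>s. s \<le> c - e \<Longrightarrow> k s = 0" "\<And>s. c + 7 * S \<le> s \<Longrightarrow> k s = 0"
      using tent_function[OF e S(2)] by blast
    define AS where "AS = A (exp (- r))"
    have intD: "set_integrable lebesgue AS (D s w)" for s w
      unfolding AS_def by (rule int_D) simp
    have "(LINT x:AS|lebesgue. u x * (W x * (bump ((\<sigma> (t x) - c) / e) / e - 2 * bump ((\<sigma> (t x) - (c + 3 * S)) / S) / S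
         + bump ((\<sigma> (t x) - (c + 6 * S)) / S) / S))) \<le> 0"
      unfolding W_def t_def N_def AS_def A_def
      by (rule solution_inequality_log_scale[OF R u \<alpha> \<sigma>(1) k(1,2,3,4)])
        (use k(5,6) c_e r rb ab in auto)
    also have "(\<lambda>x. u x * (W x * (bump ((\<sigma> (t x) - c) / e) / e - 2 * bump ((\<sigma> (t x) - (c + 3 * S)) / S) / S
         + bump ((\<sigma> (t x) - (c + 6 * S)) / S) / S))) = (\<lambda>x. D c e x - 2 * D (c + 3 * S) S x + D (c + 6 * S) S x)"
      by (simp add: fun_eq_iff D_def algebra_simps)
    also have "(LINT x:AS|lebesgue. D c e x - 2 * D (c + 3 * S) S x + D (c + 6 * S) S x) =
        (LINT x:AS|lebesgue. D c e x) - (LINT x:AS|lebesgue. 2 * D (c + 3 * S) S x) + (LINT x:AS|lebesgue. D (c + 6 * S) S x)"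
      using intD by (simp add: set_integral_add set_integral_diff)
    finally have 1: "(LINT x:AS|lebesgue. D c e x) + (LINT x:AS|lebesgue. D (c + 6 * S) S x) \<le>
        (LINT x:AS|lebesgue. 2 * D (c + 3 * S) S x)" by simp
    have 2: "0 \<le> (LINT x:AS|lebesgue. D (c + 6 * S) S x)"
      unfolding set_lebesgue_integral_def
      by (rule integral_nonneg_AE, rule AE_mp[OF D_nonneg[of "exp (- r)" S "c + 6 * S"]])
        (use S in \<open>auto simp: AS_def indicator_def\<close>)
    \<comment> \<open>The first corner does not see radii below \<open>a\<close>, so enlarging the
      annulus with \<open>n\<close> leaves its contribution equal to \<open>J\<close>.\<close>
    have 3: "(LINT x:AS|lebesgue. D c e x) = J"
      unfolding J_def set_lebesgue_integral_def
    proof (intro Bochner_Integration.integral_cong refl)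
      fix x
      show "indicator AS x *\<^sub>R D c e x = indicator (A a) x *\<^sub>R D c e x"
      proof (cases "x \<in> AS \<and> x \<notin> A a")
        case True
        then have "0 < norm x" "norm x < 1" "norm x < a" using in_A[of x "exp (- r)"] by (auto simp: AS_def A_def)
        moreover from this have "ln (norm x) < ln a" using ab by (subst ln_less_cancel_iff) auto
        ultimately have "\<sigma> (- ln a) < \<sigma> (t x)" using t(1)[of x] lnab by (intro mono) auto
        then have "1 \<le> \<bar>(\<sigma> (t x) - c) / e\<bar>" using c_e e by (simp add: abs_if field_simps)
        then show ?thesis by (simp add: D_def bump_eq_0)
      next
        case False
        then show ?thesis using ra by (auto simp: AS_def A_def indicator_def)
      qed
    qed
    have g_int: "integrable lebesgue (g (p n) q)" and g_le: "integral\<^sup>L lebesgue (g (p n) q) \<le> K * S\<^sup>2"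
    proof -
      have "0 \<le> \<sigma> (p n)" using pn S by simp
      note * = pn(1) pq this
      show "integrable lebesgue (g (p n) q)" by (rule K0(2)[OF *])
      have "\<sigma> q \<le> 5 * S\<^sup>2" "(\<sigma> q)\<^sup>2 \<le> (5 * S)\<^sup>2"
      proof -
        have "S * 1 \<le> S * S" using S by (intro mult_left_mono) auto
        then show "\<sigma> q \<le> 5 * S\<^sup>2" using q(2) S(4) unfolding power2_eq_square by linarith
        show "(\<sigma> q)\<^sup>2 \<le> (5 * S)\<^sup>2" using q S by (intro power_mono) auto
      qed
      then have "\<sigma> q + (1/2 - \<beta>) * (\<sigma> q)\<^sup>2 \<le> 5 * S\<^sup>2 + (1/2 - \<beta>) * (5 * S)\<^sup>2"
        using \<beta> by (intro add_mono mult_left_mono) auto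
      also have "\<dots> = (5 + 25 * (1/2 - \<beta>)) * S\<^sup>2" by (simp add: algebra_simps power2_eq_square)
      finally have "K0 * (\<sigma> q + (1/2 - \<beta>) * (\<sigma> q)\<^sup>2) \<le> K * S\<^sup>2"
        unfolding K_def mult.assoc by (rule mult_left_mono[OF _ K0(1)])
      then show "integral\<^sup>L lebesgue (g (p n) q) \<le> K * S\<^sup>2" using K0(3)[OF *] by simp
    qed
    have "(LINT x:AS|lebesgue. 2 * D (c + 3 * S) S x) \<le>
        (\<integral>x. \<eta> * F n x + (1 / (\<eta> * S\<^sup>2)) * g (p n) q x \<partial>lebesgue)"
      unfolding set_lebesgue_integral_def
    proof (rule integral_mono_AE)
      show "integrable lebesgue (\<lambda>x. indicator AS x *\<^sub>R (2 * D (c + 3 * S) S x))"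
        using set_integrable_mult_right[OF intD] by (simp add: set_integrable_def)
      show "integrable lebesgue (\<lambda>x. \<eta> * F n x + (1 / (\<eta> * S\<^sup>2)) * g (p n) q x)"
        by (intro Bochner_Integration.integrable_add integrable_mult_right F_int g_int)
      show "AE x in lebesgue. indicator AS x *\<^sub>R (2 * D (c + 3 * S) S x) \<le>
          \<eta> * F n x + (1 / (\<eta> * S\<^sup>2)) * g (p n) q x"
        using u(1)
      proof eventually_elim
        case (elim x)
        have rhs: "0 \<le> \<eta> * F n x + (1 / (\<eta> * S\<^sup>2)) * g (p n) q x"
          using \<eta> f_nonneg by (simp add: F_def g_def)
        show ?case
        proof (cases "x \<in> AS \<and> \<bar>\<sigma> (t x) - (c + 3 * S)\<bar> < S")
          case False
          then have "x \<in> AS \<Longrightarrow> D (c + 3 * S) S x = 0" using S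
            by (auto simp: D_def intro!: bump_eq_0)
          then show ?thesis using rhs by (auto simp: indicator_def)
        next
          case True
          have x: "0 < norm x" "norm x < 1" "x \<in> ball 0 R" "norm x \<le> b"
            using in_A[of x "exp (- r)"] True by (auto simp: AS_def A_def)
          have "p n < t x" "t x < q"
            using True mono_iff[OF pn(1) t(2)[OF x(1,2)]] mono_iff[OF t(2)[OF x(1,2)] q(1)] pn(2) q(2) by linarith+
          then have nx: "norm x \<in> {exp (- q)..exp (- p n)}"
            using t(3)[OF x(1,2), symmetric] by simp
          \<comment> \<open>\<open>P\<^sup>2\<close> is the weight of the \<open>L\<^sup>2\<close>
            hypothesis and \<open>Q\<^sup>2\<close> the integrand of \<open>g\<close>; the exponents
            add up to those of \<open>W\<close> because
            \<open>\<gamma> = \<beta> + 1/2\<close>.\<close>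
          define P where "P = norm x powr (-1) * t x powr (- \<gamma>)"
          define Q where "Q = norm x powr (- N / 2) * t x powr (1 / 2 - 2 * \<beta>)"
          have PQ: "W x = P * Q"
          proof -
            have "-2 - (N - 2) / 2 = -1 + - N / 2" "-3 * \<beta> = - \<gamma> + (1 / 2 - 2 * \<beta>)"
              by (simp_all add: \<beta>_def diff_divide_distrib)
            then show ?thesis
              unfolding W_def P_def Q_def by (simp only: powr_add mult_ac)
          qed
          have sq: "(y powr z)\<^sup>2 = y powr (2 * z)" for y z :: real
            by (simp only: power2_eq_square mult_2 powr_add)
          have P2: "F n x = (u x * P)\<^sup>2"
            unfolding P_def power_mult_distrib sq using nx R' x(4) by (simp add: F_def f_def)
          have Q2: "g (p n) q x = Q\<^sup>2"
            unfolding Q_def power_mult_distrib sq using nx by (simp add: g_def)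
          have ux: "0 \<le> u x" using elim x(3) by simp
          have "2 * D (c + 3 * S) S x \<le> 2 * (u x * P) * (Q / S)"
          proof -
            have "u x * (P * Q) / S * bump ((\<sigma> (t x) - (c + 3 * S)) / S) \<le> u x * (P * Q) / S * 1"
              using ux S by (intro mult_left_mono bump_le_1) (simp add: P_def Q_def)
            moreover have "D (c + 3 * S) S x = u x * (P * Q) / S * bump ((\<sigma> (t x) - (c + 3 * S)) / S)"
              by (simp add: D_def PQ)
            ultimately show ?thesis by simp
          qed
          \<comment> \<open>The factor \<open>1 / S\<close> is placed on \<open>Q\<close> alone, so
            that its square offsets the growth \<open>K * S\<^sup>2\<close> of the integral of
            \<open>g\<close> and the bound loses its dependence on \<open>S\<close>.\<close>
          also have "\<dots> \<le> \<eta> * (u x * P)\<^sup>2 + (1 / \<eta>) * (Q / S)\<^sup>2"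
          proof -
            have "0 \<le> (sqrt \<eta> * (u x * P) - (Q / S) / sqrt \<eta>)\<^sup>2" by simp
            also have "\<dots> = \<eta> * (u x * P)\<^sup>2 + (1 / \<eta>) * (Q / S)\<^sup>2 - 2 * (u x * P) * (Q / S)"
              using \<eta> by (simp add: power2_diff power_mult_distrib power_divide mult_ac)
            finally show ?thesis by simp
          qed
          finally show ?thesis
            using True by (simp add: P2 Q2 power_divide)
        qed
      qed
    qed
    also have "\<dots> = \<eta> * integral\<^sup>L lebesgue (F n) + (1 / (\<eta> * S\<^sup>2)) * integral\<^sup>L lebesgue (g (p n) q)"
      using F_int g_int by (subst Bochner_Integration.integral_add) auto
    also have "\<dots> \<le> \<eta> * integral\<^sup>L lebesgue (F n) + (1 / (\<eta> * S\<^sup>2)) * (K * S\<^sup>2)"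
      using g_le \<eta> by (intro add_left_mono mult_left_mono) auto
    also have "\<dots> = \<eta> * integral\<^sup>L lebesgue (F n) + K / \<eta>"
      using S by simp
    finally show ?thesis using 1 2 3 by simp
  qed
  \<comment> \<open>With \<open>\<eta>\<close> fixed, the limit in \<open>n\<close> removes the
    tail; \<open>K\<close> does not depend on \<open>\<eta>\<close>, which is then free to
    grow.\<close>
  have J_le_K: "J \<le> K / \<eta>" if "0 < \<eta>" for \<eta> :: real
  proof (rule LIMSEQ_le_const)
    show "(\<lambda>n. \<eta> * integral\<^sup>L lebesgue (F n) + K / \<eta>) \<longlonglongrightarrow> K / \<eta>"
      using tendsto_add[OF tendsto_mult_left[OF F_tendsto, of \<eta>] tendsto_const[of "K / \<eta>"]] by simp
  qed (use J_le[OF that] in blast)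
  have "J \<le> 0"
  proof (rule ccontr)
    assume "\<not> J \<le> 0"
    then have J: "0 < J" by simp
    \<comment> \<open>The witness \<open>\<eta> = (K + 1) / J\<close> turns the bound into
      \<open>J \<le> J * K / (K + 1)\<close>, impossible for positive \<open>J\<close>.\<close>
    have "J \<le> K / ((K + 1) / J)" using J K by (intro J_le_K) auto
    then have "J * (K + 1) \<le> J * K" using K by (simp add: field_simps)
    then show False using J by (simp add: algebra_simps)
  qed
  have Dn: "AE x in lebesgue. 0 \<le> indicator (A a) x *\<^sub>R D c e x"
    by (rule AE_mp[OF D_nonneg[OF ab(1) e, of c]]) (auto simp: indicator_def)
  have "integral\<^sup>L lebesgue (\<lambda>x. indicator (A a) x *\<^sub>R D c e x) = 0"
    using \<open>J \<le> 0\<close> integral_nonneg_AE[OF Dn] unfolding J_def set_lebesgue_integral_def by simp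
  then have "AE x in lebesgue. indicator (A a) x *\<^sub>R D c e x = 0"
    using integral_nonneg_eq_0_iff_AE[OF _ Dn] int_D[OF ab(1)] unfolding set_integrable_def by blast
  then show ?thesis
  proof eventually_elim
    case (elim x)
    show ?case
    proof
      assume ax: "a < norm x \<and> norm x < b"
      then have x: "x \<in> A a" "0 < norm x" "norm x < 1" using ab b1 by (auto simp: A_def)
      have "ln a < ln (norm x)" "ln (norm x) < ln b"
        using ax ab x by (subst ln_less_cancel_iff; simp)+
      then have "- ln b < t x" "t x < - ln a" using t(1)[OF x(2,3)] by auto
      then have "c - e < \<sigma> (t x)" "\<sigma> (t x) < c + e"
        using mono[of "- ln b" "t x"] mono[of "t x" "- ln a"] lnab t(2)[OF x(2,3)] c_e by auto
      then have "\<bar>(\<sigma> (t x) - c) / e\<bar> < 1" using e by (simp add: abs_if field_simps)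
      then have "0 < bump ((\<sigma> (t x) - c) / e) / e" using bump_pos e by simp
      moreover have "0 < W x" using x t(2)[OF x(2,3)] by (simp add: W_def)
      ultimately show "u x = 0" using elim x(1) by (auto simp: D_def)
    qed
  qed
qed

theorem theorem0p1:
  fixes u :: "real ^ 'n \<Rightarrow> real" and R \<alpha> :: real
  assumes "CARD('n) \<ge> 2"
    and "0 < R" and "R \<le> 1"
    and "AE x\<in>ball 0 R in lebesgue. 0 \<le> u x"
    and "distributional_solution R \<alpha> u"
    and "\<exists>\<gamma>::real. \<gamma> \<le> 1 \<and>
           u \<in> weighted_L2_loc_ball R
                 (\<lambda>x. norm x powr (-2) * \<bar>ln (norm x)\<bar> powr (-2 * \<gamma>)) \<and>
           \<alpha> \<ge> 1 / 4 - (1 - \<gamma>)\<^sup>2"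
  shows "AE x\<in>ball 0 R in lebesgue. u x = 0"
proof -
  \<comment> \<open>The annuli between \<open>a n\<close> and \<open>R - a n\<close> exhaust the
    punctured ball, and countably many null sets combine. The summand \<open>3\<close> gives
    \<open>a n \<le> R / 3\<close>, so that no annulus is degenerate.\<close>
  define a where "a n = R / (real n + 3)" for n
  have a: "0 < a n" "a n < R - a n" for n
  proof -
    show "0 < a n" using assms(2) by (simp add: a_def)
    have "a n \<le> R / 3" unfolding a_def using assms(2) by (intro divide_left_mono) auto
    then show "a n < R - a n" using assms(2) by linarith
  qed
  obtain \<gamma> :: real where \<gamma>: "\<gamma> \<le> 1"
    "u \<in> weighted_L2_loc_ball R (\<lambda>x. norm x powr (-2) * \<bar>ln (norm x)\<bar> powr (-2 * \<gamma>))"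
    "\<alpha> \<ge> 1 / 4 - (1 - \<gamma>)\<^sup>2"
    using assms(6) by blast
  have "AE x in lebesgue. a n < norm x \<and> norm x < R - a n \<longrightarrow> u x = 0" for n
    by (rule solution_vanishes_on_annulus[OF assms(3,4,5) \<gamma>(1,3,2) a]) (use a(1)[of n] in simp)
  then have "AE x in lebesgue. \<forall>n. a n < norm x \<and> norm x < R - a n \<longrightarrow> u x = 0"
    unfolding AE_all_countable by blast
  moreover have "AE x in lebesgue. x \<noteq> (0 :: real ^ 'n)"
    by (intro AE_completion AE_lborel_singleton)
  ultimately show ?thesis
  proof eventually_elim
    case (elim x)
    show ?case
    proof
      assume "x \<in> ball 0 R"
      moreover define d where "d = min (norm x) (R - norm x)"
      ultimately have d: "0 < d" "d \<le> norm x" "d \<le> R - norm x" using elim(2) by auto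
      obtain n :: nat where "R / d < real n" using reals_Archimedean2 by blast
      then have "R < real n * d" using d by (simp add: pos_divide_less_eq)
      then have "R < (real n + 3) * d" using d unfolding distrib_right by linarith
      then have "a n < d" by (simp add: a_def pos_divide_less_eq mult.commute)
      then have "a n < norm x" "norm x < R - a n" using d by auto
      then show "u x = 0" using elim(1) by auto
    qed
  qed
qed

end
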